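(* For $d\in\mathbb N$ let $p^d(t)=\sum_{i=0}^d 2^{2^{d(d-i)}}t^i$ and let $Y_d=\{x\in\mathbb C : p^d(x)=0\}$. The family $(Y_d)_{d}$ cannot be decided non-uniformly in time polylogarithmic in $d$. That is, there do not exist constants $a,b>0$ such that for every integer $d\ge 2$ there is a machine over $\mathbb C$ or a decision tree over $\mathbb C$ (which may depend on $d$) that, on every input $x\in\mathbb C$, decides whether $p^d(x)=0$ in time at most $a(\log d)^b$.
   Context: Here $p^d$ denotes a polynomial indexed by $d$ (the superscript is not a power). A decision tree over $\mathbb C$ with input $x\in\mathbb C$ is a finite rooted tree in which each internal node either performs one arithmetic operation ($+,-,\times,\div$) on two operands, each of which is the input $x$, a complex constant, or a result computed earlier on the path from the root, or is a branching node that tests whether a previously computed quantity equals $0$ and branches in two according to the answer; each leaf is labelled YES or NO. Its running time is its depth. It decides a set $S\subseteq\mathbb C$ if each $x\in S$ reaches a YES leaf and each $x\notin S$ reaches a NO leaf. A machine over $\mathbb C$ is a machine in the sense of Blum, Cucker, Shub and Smale: it may have finitely many complex constants, performs one arithmetic operation, one test for equality to zero, or one data-movement operation per step, and its running time is the number of steps. Non-uniform setting: a different machine or decision tree, with different constants, may be used for each value of $d$; the running time is measured as a function of $d$ and must be bounded for all inputs $x\in\mathbb C$. *)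

theory Defs
  imports Complex_Main "HOL-Computational_Algebra.Polynomial"
begin

datatype arith_op = Add | Sub | Mul | Div

text \<open>Division by zero is undefined, as in the Blum--Cucker--Shub--Smale model
  (it does not take the value 0 as in HOL).\<close>

fun arith :: "arith_op \<Rightarrow> complex \<Rightarrow> complex \<Rightarrow> complex option" where
  "arith Add u v = Some (u + v)"
| "arith Sub u v = Some (u - v)"
| "arith Mul u v = Some (u * v)"
| "arith Div u v = (if v = 0 then None else Some (u / v))"

text \<open>\<open>Result k\<close> is the result of the \<open>k\<close>-th (counting from 0) arithmetic node on the path from
  the root; \<open>Branch k t\<^sub>0 t\<^sub>1\<close> continues with \<open>t\<^sub>0\<close> if that result is zero and with \<open>t\<^sub>1\<close> otherwise;
  \<open>Leaf True\<close> is a YES leaf.\<close>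

datatype tree_operand = Input | Const complex | Result nat

datatype decision_tree =
    Leaf bool
  | Arith arith_op tree_operand tree_operand decision_tree
  | Branch nat decision_tree decision_tree

fun wf_operand :: "nat \<Rightarrow> tree_operand \<Rightarrow> bool" where
  "wf_operand n Input \<longleftrightarrow> True"
| "wf_operand n (Const c) \<longleftrightarrow> True"
| "wf_operand n (Result k) \<longleftrightarrow> k < n"

text \<open>\<open>n\<close> is the number of results available at the root of the tree.\<close>

fun wf_tree :: "nat \<Rightarrow> decision_tree \<Rightarrow> bool" where
  "wf_tree n (Leaf b) \<longleftrightarrow> True"
| "wf_tree n (Arith f u v t) \<longleftrightarrow> wf_operand n u \<and> wf_operand n v \<and> wf_tree (Suc n) t"
| "wf_tree n (Branch k t\<^sub>0 t\<^sub>1) \<longleftrightarrow> k < n \<and> wf_tree n t\<^sub>0 \<and> wf_tree n t\<^sub>1"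

fun tree_depth :: "decision_tree \<Rightarrow> nat" where
  "tree_depth (Leaf b) = 0"
| "tree_depth (Arith f u v t) = Suc (tree_depth t)"
| "tree_depth (Branch k t\<^sub>0 t\<^sub>1) = Suc (max (tree_depth t\<^sub>0) (tree_depth t\<^sub>1))"

fun operand_value :: "complex \<Rightarrow> complex list \<Rightarrow> tree_operand \<Rightarrow> complex" where
  "operand_value x rs Input = x"
| "operand_value x rs (Const c) = c"
| "operand_value x rs (Result k) = rs ! k"

text \<open>\<open>rs\<close> lists the results computed so far; \<open>None\<close> means that no leaf is reached because of a
  division by zero.\<close>

fun run_tree :: "complex \<Rightarrow> complex list \<Rightarrow> decision_tree \<Rightarrow> bool option" where
  "run_tree x rs (Leaf b) = Some b"
| "run_tree x rs (Arith f u v t) =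
     (case arith f (operand_value x rs u) (operand_value x rs v) of
        None \<Rightarrow> None
      | Some w \<Rightarrow> run_tree x (rs @ [w]) t)"
| "run_tree x rs (Branch k t\<^sub>0 t\<^sub>1) = (if rs ! k = 0 then run_tree x rs t\<^sub>0 else run_tree x rs t\<^sub>1)"

definition tree_decides :: "decision_tree \<Rightarrow> complex set \<Rightarrow> bool" where
  "tree_decides t S \<longleftrightarrow> wf_tree 0 t \<and>
     (\<forall>x. (x \<in> S \<longrightarrow> run_tree x [] t = Some True) \<and> (x \<notin> S \<longrightarrow> run_tree x [] t = Some False))"

text \<open>A machine is a finite flow graph, given as the list of its nodes; the numbers at the end of
  a node are the indices of its successors and computation starts at node 0. The state space is
  that of two-way infinite sequences, of which each node addresses fixed coordinates; the shift
  nodes move the whole sequence and thus give access to all of it.\<close>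

datatype machine_operand = Cell int | Constant complex

datatype node =
    Compute int arith_op machine_operand machine_operand nat
  | Assign int machine_operand nat
  | Test_Zero int nat nat
  | Shift_Left nat
  | Shift_Right nat
  | Output

type_synonym machine = "node list"
type_synonym tape = "int \<Rightarrow> complex"

fun successors :: "node \<Rightarrow> nat set" where
  "successors (Compute i f u v q) = {q}"
| "successors (Assign i u q) = {q}"
| "successors (Test_Zero i q\<^sub>0 q\<^sub>1) = {q\<^sub>0, q\<^sub>1}"
| "successors (Shift_Left q) = {q}"
| "successors (Shift_Right q) = {q}"
| "successors Output = {}"

definition wf_machine :: "machine \<Rightarrow> bool" where
  "wf_machine M \<longleftrightarrow> M \<noteq> [] \<and> (\<forall>nd \<in> set M. \<forall>q \<in> successors nd. q < length M)"

fun cell_value :: "tape \<Rightarrow> machine_operand \<Rightarrow> complex" where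
  "cell_value s (Cell i) = s i"
| "cell_value s (Constant c) = c"

text \<open>There is no next configuration at an output node and after a division by zero; only the
  former counts as halting.\<close>

fun exec_node :: "node \<Rightarrow> tape \<Rightarrow> (nat \<times> tape) option" where
  "exec_node (Compute i f u v q) s =
     (case arith f (cell_value s u) (cell_value s v) of
        None \<Rightarrow> None
      | Some w \<Rightarrow> Some (q, s(i := w)))"
| "exec_node (Assign i u q) s = Some (q, s(i := cell_value s u))"
| "exec_node (Test_Zero i q\<^sub>0 q\<^sub>1) s = Some (if s i = 0 then q\<^sub>0 else q\<^sub>1, s)"
| "exec_node (Shift_Left q) s = Some (q, \<lambda>i. s (i + 1))"
| "exec_node (Shift_Right q) s = Some (q, \<lambda>i. s (i - 1))"
| "exec_node Output s = None"

definition machine_step :: "machine \<Rightarrow> nat \<times> tape \<Rightarrow> nat \<times> tape \<Rightarrow> bool" where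
  "machine_step M c c' \<longleftrightarrow> exec_node (M ! fst c) (snd c) = Some c'"

text \<open>An input of length one is placed in coordinate 1, preceded by its length in unary.\<close>

definition input_tape :: "complex \<Rightarrow> tape" where
  "input_tape x = (\<lambda>i. 0)(0 := 1, 1 := x)"

definition machine_outputs :: "machine \<Rightarrow> complex \<Rightarrow> complex \<Rightarrow> nat \<Rightarrow> bool" where
  "machine_outputs M x y n \<longleftrightarrow>
     (\<exists>q s. (machine_step M ^^ n) (0, input_tape x) (q, s) \<and> M ! q = Output \<and> s 1 = y)"

text \<open>Deciding a set means computing its characteristic function.\<close>

definition machine_decides_in_time :: "machine \<Rightarrow> complex set \<Rightarrow> real \<Rightarrow> bool" where
  "machine_decides_in_time M S \<tau> \<longleftrightarrow> wf_machine M \<and>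
     (\<forall>x. \<exists>n. real n \<le> \<tau> \<and> machine_outputs M x (if x \<in> S then 1 else 0) n)"

definition p_poly :: "nat \<Rightarrow> complex poly" where
  "p_poly d = (\<Sum>i = 0..d. monom (2 ^ (2 ^ (d * (d - i)))) i)"

definition Y :: "nat \<Rightarrow> complex set" where
  "Y d = {x. poly (p_poly d) x = 0}"

end

theory Submission
  imports
    Defs
    "HOL-Computational_Algebra.Fundamental_Theorem_Algebra"
    "HOL-Library.FuncSet"
    "HOL-Real_Asymp.Real_Asymp"
begin

text \<open>
  Let a decision tree of depth \<open>h\<close> decide the set of roots of \<open>p = p_poly d\<close>. Only finitely
  many inputs leave the path on which every test of a quantity that is not identically zero
  answers ``nonzero''; this path leads to NO, so every root of \<open>p\<close> leaves it
  (\<open>ex_poly_vanishing_on_decided_set\<close>). Hence all roots of \<open>p\<close> are roots of one nonzero polynomial \<open>Q\<close>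
  with coefficients in the ring generated by the at most \<open>2 h\<close> constants on the path; its degree,
  and the logarithm of the size of its integer coefficients, are at most \<open>2^(2 h)\<close>.

  On the one hand, this makes the roots of \<open>p\<close> dependent. By division with remainder modulo \<open>Q\<close>,
  monomials with exponents below \<open>\<Delta>\<close> in \<open>2 h + 2\<close> roots are, after scaling, integer combinations of
  few products of constants and roots. Counting shows that two different sets of such
  monomials have the same sum as soon as \<open>\<Delta>\<close> is at least \<open>2^(10 (h + 1)^2)\<close>
  (\<open>subset_sums_collide\<close>, \<open>collision_count\<close>).

  On the other hand, the Newton polygon of \<open>p\<close> with respect to an extension of the 2-adic valuation
  to the complex numbers has the \<open>d\<close> slopes \<open>(B - 1) B^k\<close>, \<open>k < d\<close>, where \<open>B = 2^d\<close>, and so \<open>p\<close> has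
  roots of these valuations (\<open>ex_root_of_valuation\<close>). Different monomials in them with exponents
  below \<open>B\<close> have different valuations, so different sets of such monomials have different sums
  (\<open>p_poly_roots_subset_sums\<close>). Therefore \<open>d < 10 (h + 1)^2\<close> (\<open>tree_depth_lower_bound\<close>), which
  excludes polylogarithmic depth. A machine that runs for \<open>T\<close> steps unrolls to a tree of depth at most
  \<open>2 T + 2\<close> (\<open>machine_to_tree\<close>).
\<close>

section \<open>Valuation rings of the complex numbers above 2\<close>

text \<open>Subrings of the field of complex numbers, as sets.\<close>

locale complex_subring =
  fixes A :: "complex set"
  assumes one_mem: "1 \<in> A"
    and diff_mem: "x \<in> A \<Longrightarrow> y \<in> A \<Longrightarrow> x - y \<in> A"
    and mult_mem: "x \<in> A \<Longrightarrow> y \<in> A \<Longrightarrow> x * y \<in> A"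
begin

lemma zero_mem: "0 \<in> A"
  using diff_mem[OF one_mem one_mem] by simp

lemma add_mem: "x \<in> A \<Longrightarrow> y \<in> A \<Longrightarrow> x + y \<in> A"
  using diff_mem[of x "0 - y"] diff_mem[of 0 y] zero_mem by simp

lemma two_mem: "2 \<in> A"
  using add_mem[OF one_mem one_mem] by simp

lemma power_mem: "x \<in> A \<Longrightarrow> x ^ n \<in> A"
  by (induction n) (auto intro: one_mem mult_mem)

lemma sum_mem: "(\<And>i. i \<in> I \<Longrightarrow> f i \<in> A) \<Longrightarrow> sum f I \<in> A"
  by (induction I rule: infinite_finite_induct) (auto intro: zero_mem add_mem)

text \<open>The polynomials with coefficients in the subring; their values at \<open>x\<close> form the subring
  generated by the given one and \<open>x\<close>.\<close>

definition polys :: "complex poly set" where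
  "polys = {f. \<forall>i. coeff f i \<in> A}"

lemma polysD: "f \<in> polys \<Longrightarrow> coeff f i \<in> A"
  by (simp add: polys_def)

lemma polys_diff: "f \<in> polys \<Longrightarrow> g \<in> polys \<Longrightarrow> f - g \<in> polys"
  by (simp add: polys_def diff_mem)

lemma polys_mult: "f \<in> polys \<Longrightarrow> g \<in> polys \<Longrightarrow> f * g \<in> polys"
  by (auto simp: polys_def coeff_mult intro!: sum_mem mult_mem)

lemma polys_smult: "a \<in> A \<Longrightarrow> f \<in> polys \<Longrightarrow> smult a f \<in> polys"
  by (simp add: polys_def mult_mem)

lemma polys_monom: "a \<in> A \<Longrightarrow> monom a n \<in> polys"
  by (simp add: polys_def zero_mem)

lemma polys_reflect: "f \<in> polys \<Longrightarrow> reflect_poly f \<in> polys"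
  by (simp add: polys_def coeff_reflect_poly zero_mem)

lemma subring_adjoin: "complex_subring ((\<lambda>f. poly f x) ` polys)"
proof
  show "1 \<in> (\<lambda>f. poly f x) ` polys"
    using polys_monom[OF one_mem, of 0] by (auto simp: monom_0 intro!: image_eqI[of _ _ "[:1:]"])
qed (auto intro: polys_diff polys_mult simp flip: poly_diff poly_mult)

lemma subset_adjoin: "A \<subseteq> (\<lambda>f. poly f x) ` polys"
proof
  fix a assume "a \<in> A"
  thus "a \<in> (\<lambda>f. poly f x) ` polys"
    using polys_monom[of a 0] by (auto simp: monom_0 intro!: image_eqI[of _ _ "[:a:]"])
qed

lemma mem_adjoin: "x \<in> (\<lambda>f. poly f x) ` polys"
  using polys_monom[OF one_mem, of 1] by (force simp: poly_monom intro!: image_eqI[of _ _ "monom 1 1"])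

end

text \<open>Subrings maximal among those in which 2 is not invertible. They turn out to be valuation
  rings: of every nonzero complex number and its inverse they contain at least one.\<close>

locale maximal_subring = complex_subring +
  assumes half_notin: "1/2 \<notin> A"
    and maximal: "complex_subring A' \<Longrightarrow> A \<subseteq> A' \<Longrightarrow> 1/2 \<notin> A' \<Longrightarrow> A' = A"
begin

lemma half_in_adjoin:
  assumes "x \<notin> A"
  shows "\<exists>f\<in>polys. poly f x = 1/2"
proof (rule ccontr)
  assume "\<not> ?thesis"
  hence "1/2 \<notin> (\<lambda>f. poly f x) ` polys" by force
  from maximal[OF subring_adjoin subset_adjoin this] mem_adjoin[of x] assms
  show False by simp
qed

text \<open>Elements congruent to 1 modulo 2 are invertible: adjoining the inverse of
  \<open>u = 1 - 2 b\<close> cannot produce \<open>1/2\<close>, since \<open>1/2 = f(1/u)\<close> would give \<open>u^n \<in> 2 A\<close>.\<close>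

lemma one_minus_even_unit:
  assumes b: "b \<in> A"
  shows "1 - 2 * b \<noteq> 0" and "inverse (1 - 2 * b) \<in> A"
proof -
  define u where "u = 1 - 2 * b"
  show u0: "1 - 2 * b \<noteq> 0"
  proof
    assume "1 - 2 * b = 0"
    hence "b = 1/2" by (simp add: field_simps)
    with b half_notin show False by simp
  qed
  have uA: "u \<in> A" unfolding u_def by (intro diff_mem one_mem mult_mem two_mem b)
  have pw: "\<exists>c\<in>A. u ^ n = 1 - 2 * c" for n
  proof (induction n)
    case 0 show ?case by (rule bexI[OF _ zero_mem]) simp
  next
    case (Suc n)
    then obtain c where c: "c \<in> A" "u ^ n = 1 - 2 * c" by blast
    have "u ^ Suc n = u * (1 - 2 * c)" by (simp add: c(2))
    also have "\<dots> = 1 - 2 * (b + u * c)" by (simp add: u_def algebra_simps)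
    finally have "u ^ Suc n = 1 - 2 * (b + u * c)" .
    moreover have "b + u * c \<in> A" by (intro add_mem mult_mem b uA c)
    ultimately show ?case by blast
  qed
  show "inverse (1 - 2 * b) \<in> A"
  proof (rule ccontr)
    assume "inverse (1 - 2 * b) \<notin> A"
    then obtain f where f: "f \<in> polys" "poly f (inverse u) = 1/2"
      using half_in_adjoin u_def by blast
    let ?n = "degree f"
    have rf: "poly (reflect_poly f) u = u ^ ?n / 2"
      using u0 f(2) by (simp add: poly_reflect_poly_nz u_def)
    have 1: "poly (reflect_poly f) u \<in> A"
      unfolding poly_altdef
      by (intro sum_mem mult_mem power_mem uA polysD polys_reflect f)
    obtain c where c: "c \<in> A" "u ^ ?n = 1 - 2 * c" using pw by blast
    have "poly (reflect_poly f) u + c = 1/2" by (simp add: rf c(2) diff_divide_distrib)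
    with add_mem[OF 1 c(1)] half_notin show False by simp
  qed
qed

text \<open>If neither \<open>x\<close> nor its inverse were in the ring, adjoining either of them would produce \<open>1/2\<close>.
  The relation \<open>g(1/x) = 1/2\<close> yields a monic equation \<open>h(x) = 0\<close> of degree at most that of \<open>f\<close>,
  because \<open>1 - 2 g(0)\<close> is a unit, and reduction modulo \<open>h\<close> lowers the degree of \<open>f\<close>.\<close>

lemma no_two_representations:
  assumes x: "x \<noteq> 0"
    and f: "f \<in> polys" "poly f x = 1/2"
    and g: "g \<in> polys" "poly g (inverse x) = 1/2"
    and le: "degree g \<le> degree f"
    and minimal: "\<And>f'. f' \<in> polys \<Longrightarrow> poly f' x = 1/2 \<Longrightarrow> degree f \<le> degree f'"
  shows False
proof -
  define k where "k = degree g"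
  define n where "n = degree f"
  define u where "u = 1 - 2 * coeff g 0"
  have g0: "coeff g 0 \<in> A" by (rule polysD[OF g(1)])
  have u: "u \<noteq> 0" "inverse u \<in> A" using one_minus_even_unit[OF g0] by (auto simp: u_def)
  have k: "k > 0"
  proof (rule ccontr)
    assume "\<not> k > 0"
    hence "degree g = 0" by (simp add: k_def)
    then obtain a where "g = [:a:]" by (elim degree_eq_zeroE)
    with g(2) have "coeff g 0 = 1/2" by simp
    with g0 half_notin show False by simp
  qed
  \<comment> \<open>The top coefficient of \<open>X^k - 2 X^k g(1/X)\<close> is \<open>u\<close>, so that \<open>h\<close> is monic.\<close>
  define h where "h = smult (inverse u) (monom 1 k - smult 2 (reflect_poly g))"
  have hA: "h \<in> polys"
    unfolding h_def
    by (intro polys_smult polys_diff polys_monom polys_reflect one_mem two_mem u g)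
  have hx: "poly h x = 0"
    using x by (simp add: h_def poly_monom poly_reflect_poly_nz k_def g(2))
  have hk: "coeff h k = 1"
    using u by (simp add: h_def coeff_reflect_poly k_def u_def)
  have hdeg: "degree h \<le> k"
    unfolding h_def
    by (intro order_trans[OF degree_smult_le] degree_diff_le degree_monom_le)
       (auto simp: k_def intro: degree_reflect_poly_le)
  define f' where "f' = f - smult (coeff f n) (monom 1 (n - k) * h)"
  have fA: "f' \<in> polys"
    unfolding f'_def
    by (intro polys_diff polys_smult polys_mult polys_monom one_mem f hA polysD)
  have fx: "poly f' x = 1/2" using f hx by (simp add: f'_def)
  have "coeff (monom 1 (n - k) * h) n = 1"
    using le hk by (simp add: coeff_monom_mult k_def n_def)
  hence top: "coeff f' n = 0" by (simp add: f'_def)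
  have "degree (monom 1 (n - k) * h) \<le> (n - k) + k"
    by (intro order_trans[OF degree_mult_le] add_mono degree_monom_le hdeg)
  hence "degree f' \<le> n"
    unfolding f'_def using le
    by (intro degree_diff_le order_trans[OF degree_smult_le]) (auto simp: n_def k_def)
  moreover have "degree f' \<noteq> n"
  proof
    assume *: "degree f' = n"
    with top have "f' = 0" by (metis leading_coeff_0_iff)
    with * k le show False by (simp add: n_def k_def)
  qed
  ultimately have "degree f' < n" by simp
  with minimal[OF fA fx] show False by (simp add: n_def)
qed

lemma mem_or_inverse_mem: "x \<in> A \<or> inverse x \<in> A"
proof (rule ccontr)
  assume *: "\<not> ?thesis"
  have x0: "x \<noteq> 0" using * zero_mem by auto
  have ex: "\<exists>f. (f \<in> polys \<and> poly f y = 1/2) \<and>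
      (\<forall>f'. f' \<in> polys \<and> poly f' y = 1/2 \<longrightarrow> degree f \<le> degree f')"
    if "y \<notin> A" for y
    using half_in_adjoin[OF that]
      ex_has_least_nat[of "\<lambda>f. f \<in> polys \<and> poly f y = 1/2" _ degree] by blast
  from * obtain f where f: "f \<in> polys" "poly f x = 1/2"
    and fmin: "\<And>f'. f' \<in> polys \<Longrightarrow> poly f' x = 1/2 \<Longrightarrow> degree f \<le> degree f'"
    using ex[of x] by blast
  from * obtain g where g: "g \<in> polys" "poly g (inverse x) = 1/2"
    and gmin: "\<And>f'. f' \<in> polys \<Longrightarrow> poly f' (inverse x) = 1/2 \<Longrightarrow> degree g \<le> degree f'"
    using ex[of "inverse x"] by blast
  show False
  proof (cases "degree g \<le> degree f")
    case True
    show False by (rule no_two_representations[OF x0 f g True fmin])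
  next
    case False
    show False
      by (rule no_two_representations[of "inverse x" g f])
         (use x0 f g gmin False in auto)
  qed
qed

end

lemma half_not_Ints: "(1/2 :: complex) \<notin> \<int>"
proof
  assume "(1/2 :: complex) \<in> \<int>"
  then obtain z :: int where "(1/2 :: complex) = of_int z" by (elim Ints_cases)
  hence "(of_int (2 * z) :: complex) = of_int 1" by (simp add: field_simps)
  hence "2 * z = 1" by (simp only: of_int_eq_iff)
  thus False by presburger
qed

lemma ex_maximal_subring: "\<exists>A. maximal_subring A"
proof -
  let ?S = "{A. complex_subring A \<and> 1/2 \<notin> A}"
  have ints: "complex_subring \<int>" by unfold_locales auto
  have "\<exists>A\<in>?S. \<forall>X\<in>?S. A \<subseteq> X \<longrightarrow> X = A"
  proof (rule subset_Zorn_nonempty)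
    show "?S \<noteq> {}" using ints half_not_Ints by blast
  next
    fix C assume C: "C \<noteq> {}" "subset.chain ?S C"
    have ring: "complex_subring A" "1/2 \<notin> A" if "A \<in> C" for A
      using that C(2) by (auto simp: subset_chain_def)
    have common: "\<exists>A\<in>C. x \<in> A \<and> y \<in> A" if "x \<in> \<Union>C" "y \<in> \<Union>C" for x y
    proof -
      from that obtain A B where "A \<in> C" "x \<in> A" "B \<in> C" "y \<in> B" by blast
      moreover from this C(2) have "A \<subseteq> B \<or> B \<subseteq> A" by (auto simp: subset_chain_def)
      ultimately show ?thesis by blast
    qed
    have "complex_subring (\<Union>C)"
    proof
      show "1 \<in> \<Union>C" using C(1) ring complex_subring.one_mem by blast
    next
      fix x y assume "x \<in> \<Union>C" "y \<in> \<Union>C"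
      then obtain A where A: "A \<in> C" "x \<in> A" "y \<in> A" using common by blast
      then show "x - y \<in> \<Union>C" "x * y \<in> \<Union>C"
        using ring(1)[OF A(1)] complex_subring.diff_mem complex_subring.mult_mem by blast+
    qed
    with ring show "\<Union>C \<in> ?S" by blast
  qed
  then obtain A where A: "complex_subring A" "1/2 \<notin> A"
    and mx: "\<And>X. complex_subring X \<Longrightarrow> 1/2 \<notin> X \<Longrightarrow> A \<subseteq> X \<Longrightarrow> X = A" by blast
  interpret complex_subring A by fact
  have "maximal_subring A" by unfold_locales (use A mx in auto)
  thus ?thesis by blast
qed

text \<open>A valuation ring of the complex numbers in whose residue field 2 vanishes. It plays the role
  of an extension of the 2-adic valuation to the complex numbers: \<open>x\<close> has the valuation of
  \<open>2^n\<close> if \<open>x / 2^n\<close> is a unit.\<close>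

locale dyadic_valuation_ring = complex_subring V for V +
  assumes half_notin: "1/2 \<notin> V"
    and total: "x \<in> V \<or> inverse x \<in> V"
begin

text \<open>The units of \<open>V\<close>: the numbers of valuation zero.\<close>

definition unit :: "complex \<Rightarrow> bool" where
  "unit x \<longleftrightarrow> x \<noteq> 0 \<and> x \<in> V \<and> inverse x \<in> V"

text \<open>The maximal ideal of \<open>V\<close>: the numbers of positive valuation, and 0.\<close>

definition small :: "complex \<Rightarrow> bool" where
  "small x \<longleftrightarrow> x \<in> V \<and> \<not> unit x"

lemma unit_1: "unit 1" by (simp add: unit_def one_mem)

lemma unit_mult: "unit x \<Longrightarrow> unit y \<Longrightarrow> unit (x * y)"
  by (auto simp: unit_def mult_mem)

lemma unit_inverse: "unit x \<Longrightarrow> unit (inverse x)"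
  by (auto simp: unit_def)

lemma unit_divide: "unit x \<Longrightarrow> unit y \<Longrightarrow> unit (x / y)"
  by (simp add: divide_inverse unit_mult unit_inverse)

lemma unit_power: "unit x \<Longrightarrow> unit (x ^ n)"
  by (induction n) (auto intro: unit_1 unit_mult)

lemma unit_prod: "(\<And>i. i \<in> I \<Longrightarrow> unit (f i)) \<Longrightarrow> unit (prod f I)"
  by (induction I rule: infinite_finite_induct) (auto intro: unit_1 unit_mult)

lemma uminus_mem_iff [simp]: "- x \<in> V \<longleftrightarrow> x \<in> V"
  using diff_mem[OF zero_mem, of x] diff_mem[OF zero_mem, of "- x"] by auto

lemma unit_uminus_iff [simp]: "unit (- x) \<longleftrightarrow> unit x"
  by (auto simp: unit_def)

lemma small_0: "small 0" by (simp add: small_def unit_def zero_mem)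

lemma small_mult: "small x \<Longrightarrow> y \<in> V \<Longrightarrow> small (x * y)"
proof -
  assume x: "small x" and y: "y \<in> V"
  have "\<not> unit (x * y)"
  proof
    assume u: "unit (x * y)"
    hence x0: "x \<noteq> 0" and "inverse x = y * inverse (x * y)" by (auto simp: unit_def)
    moreover have "y * inverse (x * y) \<in> V"
      using u by (intro mult_mem y) (simp add: unit_def)
    ultimately have "inverse x \<in> V" by (simp only:)
    with x0 show False using x by (simp add: unit_def small_def)
  qed
  with x y show ?thesis by (auto simp: small_def mult_mem)
qed

lemma not_unit_cases:
  assumes "\<not> unit x" "x \<noteq> 0"
  shows "small x \<or> small (inverse x)"
  using assms total[of x] by (auto simp: small_def unit_def)

lemma small_add:
  assumes x: "small x" and y: "small y"
  shows "small (x + y)"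
proof -
  have main: "small (x + y)" if "small x" "small y" "y \<noteq> 0" "x / y \<in> V" for x y
  proof -
    have "x + y = y * (1 + x / y)" using that by (simp add: field_simps)
    moreover have "small (y * (1 + x / y))"
      by (intro small_mult add_mem one_mem that)
    ultimately show ?thesis by simp
  qed
  show ?thesis
  proof (cases "x = 0 \<or> y = 0")
    case False
    have "x / y \<in> V \<or> y / x \<in> V" using total[of "x / y"] by simp
    with main[OF x y] main[OF y x] False show ?thesis by (auto simp: add.commute)
  qed (use x y in auto)
qed

lemma small_sum: "(\<And>i. i \<in> I \<Longrightarrow> small (f i)) \<Longrightarrow> small (sum f I)"
  by (induction I rule: infinite_finite_induct) (auto intro: small_0 small_add)

lemma small_uminus_iff [simp]: "small (- x) \<longleftrightarrow> small x"
  by (simp add: small_def)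

lemma unit_add_small:
  assumes "unit u" "small x"
  shows "unit (u + x)"
proof (rule ccontr)
  assume "\<not> unit (u + x)"
  hence "small (u + x)" using assms add_mem by (auto simp: small_def unit_def)
  from small_add[OF this, of "- x"] assms(2) have "small u" by simp
  with assms(1) show False by (simp add: small_def)
qed

lemma small_add_unit: "small x \<Longrightarrow> unit u \<Longrightarrow> unit (x + u)"
  using unit_add_small by (simp add: add.commute)

lemma small_2: "small 2"
  using half_notin two_mem by (auto simp: small_def unit_def inverse_eq_divide)

lemma small_power_2: "n > 0 \<Longrightarrow> small (2 ^ n)"
  using small_mult[OF small_2 power_mem[OF two_mem]] by (cases n) auto

lemma unit_root_of_unity:
  assumes "x ^ Suc n = 1"
  shows "unit x"
proof -
  have x0: "x \<noteq> 0" using assms by auto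
  have 1: "inverse x = x ^ n" by (rule inverse_unique) (use assms in simp)
  hence "inverse (inverse x) = inverse (x ^ n)" by (rule arg_cong)
  hence 2: "x = inverse x ^ n" by (simp add: power_inverse)
  have "inverse x \<in> V" if "x \<in> V"
    unfolding 1 by (rule power_mem[OF that])
  moreover have "x \<in> V" if "inverse x \<in> V"
    by (subst 2) (rule power_mem[OF that])
  ultimately show ?thesis using total[of x] x0 by (auto simp: unit_def)
qed

end

lemma ex_dyadic_valuation_ring: "\<exists>V. dyadic_valuation_ring V"
proof -
  obtain A where "maximal_subring A" using ex_maximal_subring by blast
  then interpret maximal_subring A .
  have "dyadic_valuation_ring A" by unfold_locales (auto simp: half_notin mem_or_inverse_mem)
  thus ?thesis by blast
qed

section \<open>Roots of the polynomials and their valuations\<close>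

context dyadic_valuation_ring
begin

lemma small_minus_unit: "small x \<Longrightarrow> unit u \<Longrightarrow> unit (x - u)"
  using small_add_unit[of x "- u"] by simp

lemma unit_minus_small: "small x \<Longrightarrow> unit u \<Longrightarrow> unit (u - x)"
  using unit_add_small[of u "- x"] by simp

text \<open>If no root of \<open>p\<close> has the valuation of \<open>y\<close>, then the valuation of \<open>p(v)\<close> is the same for all
  \<open>v\<close> with the valuation of \<open>y\<close>, since this holds for each linear factor.\<close>

lemma poly_ratio_unit:
  assumes "p \<noteq> 0" and y: "y \<noteq> 0" and w: "unit w"
    and no_root: "\<And>x. poly p x = 0 \<Longrightarrow> \<not> unit (x / y)"
  shows "poly p y \<noteq> 0 \<and> unit (poly p (y * w) / poly p y)"
  using assms(1) no_root
proof (induction "degree p" arbitrary: p)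
  case 0
  then obtain a where "p = [:a:]" by (metis degree_eq_zeroE)
  with 0 show ?case by (simp add: unit_1)
next
  case (Suc n)
  have "\<not> constant (poly p)" using Suc.hyps(2) by (simp add: constant_degree)
  then obtain z where z: "poly p z = 0" using fundamental_theorem_of_algebra by blast
  then obtain q where q: "p = [:- z, 1:] * q" by (metis dvdE poly_eq_0_iff_dvd)
  have q0: "q \<noteq> 0" using Suc.prems(1) q by auto
  have "degree p = Suc (degree q)"
    unfolding q using q0 by (subst degree_mult_eq) auto
  hence "degree q = n" using Suc.hyps(2) by simp
  hence IH: "poly q y \<noteq> 0" "unit (poly q (y * w) / poly q y)"
    using Suc.hyps(1)[of q] q0 Suc.prems(2) q by auto
  have nu: "\<not> unit (z / y)" using z Suc.prems(2) by blast
  have fac: "y - z \<noteq> 0 \<and> unit ((y * w - z) / (y - z))"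
  proof (cases "small (z / y)")
    case True
    have u: "unit (1 - z / y)" "unit (w - z / y)"
      using unit_minus_small[OF True] unit_1 w by auto
    have "y - z = y * (1 - z / y)" "y * w - z = y * (w - z / y)"
      using y by (simp_all add: field_simps)
    with u y unit_divide[OF u(2,1)] show ?thesis by (simp add: unit_def)
  next
    case False
    hence z0: "z \<noteq> 0" using small_0 by auto
    hence s: "small (y / z)" using not_unit_cases[OF nu] False y by simp
    have u: "unit (y / z - 1)" "unit (y / z * w - 1)"
      using small_minus_unit[OF s unit_1] small_minus_unit[OF small_mult[OF s, of w] unit_1] w
      by (auto simp: unit_def)
    have "y - z = z * (y / z - 1)" "y * w - z = z * (y / z * w - 1)"
      using z0 by (simp_all add: field_simps)
    with u z0 unit_divide[OF u(2,1)] show ?thesis by (simp add: unit_def)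
  qed
  have "poly p y \<noteq> 0" using fac IH by (simp add: q)
  moreover have "poly p (y * w) / poly p y =
      ((y * w - z) / (y - z)) * (poly q (y * w) / poly q y)"
    unfolding q poly_mult by simp
  moreover have "unit \<dots>" using fac IH by (intro unit_mult) auto
  ultimately show ?case by (simp only:) simp
qed

end

lemma geometric_gap:
  fixes B :: nat
  assumes "B \<ge> 2"
  shows "n * (B - 1) * B ^ k \<le> B ^ (k + n) - B ^ k"
proof (induction n)
  case (Suc n)
  have "B ^ (k + Suc n) - B ^ k = (B ^ (k + n) - B ^ k) + (B - 1) * B ^ (k + n)"
    using assms power_increasing[of k "k + n" B] by (simp add: algebra_simps diff_mult_distrib)
  moreover have "(B - 1) * B ^ k \<le> (B - 1) * B ^ (k + n)"
    using assms by (intro mult_left_mono power_increasing) auto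
  moreover have "Suc n * (B - 1) * B ^ k = n * (B - 1) * B ^ k + (B - 1) * B ^ k"
    by (simp add: add_mult_distrib)
  ultimately show ?case using Suc by linarith
qed auto

text \<open>With \<open>B = 2^d\<close> and \<open>s = B^(k+1) - B^k\<close>, the term of \<open>p_poly d\<close> of degree \<open>d - l\<close> has at
  \<open>2^s\<close> the valuation \<open>B^l + (d - l) s\<close>. The lemma says that its minimum is attained exactly at
  \<open>l = k\<close> and \<open>l = k + 1\<close>: the edges of the Newton polygon all have length one.\<close>

lemma term_exponent:
  fixes B d k l :: nat
  assumes B: "B \<ge> 2" and k: "k < d" and l: "l \<le> d"
  defines "s \<equiv> (B - 1) * B ^ k"
  defines "F \<equiv> B ^ k + (d - k) * s"
  shows "l = k \<or> l = Suc k \<Longrightarrow> B ^ l + (d - l) * s = F"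
    and "l \<noteq> k \<Longrightarrow> l \<noteq> Suc k \<Longrightarrow> B ^ l + (d - l) * s > F"
proof -
  have s: "s + B ^ k = B ^ Suc k" using B by (simp add: s_def algebra_simps diff_mult_distrib)
  have s0: "s > 0" using B by (simp add: s_def)
  have dk: "d - k = Suc (d - Suc k)" using k by simp
  have F': "F = B ^ Suc k + (d - Suc k) * s"
    unfolding F_def dk using s by simp
  show "l = k \<or> l = Suc k \<Longrightarrow> B ^ l + (d - l) * s = F"
    using F' F_def by auto
  assume ne: "l \<noteq> k" "l \<noteq> Suc k"
  show "B ^ l + (d - l) * s > F"
  proof (cases "l < k")
    case True
    then have "d - l = (d - k) + (k - l)" using k by simp
    hence "(d - l) * s = (d - k) * s + (k - l) * s" by (simp only: add_mult_distrib)
    moreover have "(k - l) * s \<ge> 1 * s" using True by (intro mult_right_mono) auto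
    moreover have "s \<ge> B ^ k" using B by (simp add: s_def)
    moreover have "B ^ l > 0" using B by simp
    ultimately show ?thesis unfolding F_def by linarith
  next
    case False
    define n where "n = l - Suc k"
    have n: "n > 0" "l = Suc k + n" using False ne by (auto simp: n_def)
    have "d - Suc k = (d - l) + n" using n l by simp
    hence "(d - Suc k) * s = (d - l) * s + n * s" by (simp only: add_mult_distrib)
    moreover have "n * (B - 1) * B ^ Suc k \<le> B ^ l - B ^ Suc k"
      using geometric_gap[OF B, of n "Suc k"] n by simp
    moreover have "n * s < n * (B - 1) * B ^ Suc k"
      using n B by (simp add: s_def)
    moreover have "B ^ l \<ge> B ^ Suc k" using B n by (intro power_increasing) auto
    ultimately show ?thesis unfolding F' by linarith
  qed
qed

lemma coeff_p_poly: "coeff (p_poly d) i = (if i \<le> d then 2 ^ (2 ^ (d * (d - i))) else 0)"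
proof -
  have "coeff (p_poly d) i = (\<Sum>j=0..d. if j = i then 2 ^ (2 ^ (d * (d - j))) else 0)"
    by (simp add: p_poly_def coeff_sum)
  also have "\<dots> = (if i \<le> d then 2 ^ (2 ^ (d * (d - i))) else 0)"
    by (subst sum.delta) auto
  finally show ?thesis .
qed

lemma p_poly_nonzero: "p_poly d \<noteq> 0"
  using coeff_p_poly[of d 0] by auto

lemma poly_p_poly: "poly (p_poly d) x = (\<Sum>l=0..d. 2 ^ ((2 ^ d) ^ l) * x ^ (d - l))"
proof -
  have "poly (p_poly d) x = (\<Sum>i=0..d. 2 ^ (2 ^ (d * (d - i))) * x ^ i)"
    by (simp add: p_poly_def poly_sum poly_monom)
  also have "\<dots> = (\<Sum>l=0..d. 2 ^ (2 ^ (d * (d - (d - l)))) * x ^ (d - l))"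
    by (rule sum.reindex_bij_witness[of _ "\<lambda>l. d - l" "\<lambda>l. d - l"]) auto
  also have "\<dots> = (\<Sum>l=0..d. 2 ^ ((2 ^ d) ^ l) * x ^ (d - l))"
    by (intro sum.cong) (auto simp: power_mult)
  finally show ?thesis .
qed

context dyadic_valuation_ring
begin

text \<open>Every slope \<open>s\<close> of the Newton polygon is the valuation of a root. Otherwise \<open>p(2^s)\<close> and
  \<open>p(2^s w)\<close> would have the same valuation, for a primitive cube root of unity \<open>w\<close>. But up to
  the factor \<open>2^F\<close> and elements of positive valuation, the first is \<open>1 + 1\<close> and the second is
  \<open>1 + w = - w^2\<close> times a power of \<open>w\<close>.\<close>

lemma ex_root_of_valuation:
  assumes k: "k < d"
  shows "\<exists>x. poly (p_poly d) x = 0 \<and> unit (x / 2 ^ ((2 ^ d - 1) * (2 ^ d) ^ k))"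
proof (rule ccontr)
  assume none: "\<not> ?thesis"
  define B :: nat where "B = 2 ^ d"
  define s where "s = (B - 1) * B ^ k"
  define F where "F = B ^ k + (d - k) * s"
  have B: "B \<ge> 2" using k unfolding B_def by (cases d) auto
  define w where "w = cis (2 * pi / 3)"
  have w3: "w ^ 3 = 1" by (simp add: w_def DeMoivre)
  have w1: "w \<noteq> 1"
  proof
    assume "w = 1"
    hence "cos (2 * pi / 3) = 1" by (simp add: w_def complex_eq_iff)
    thus False using cos_120 by simp
  qed
  have wu: "unit w" using w3 by (intro unit_root_of_unity[of w 2]) (simp add: numeral_3_eq_3)
  have "(w - 1) * (1 + w + w ^ 2) = w ^ 3 - 1" by (simp add: algebra_simps power2_eq_square power3_eq_cube)
  hence "1 + w + w ^ 2 = 0" using w3 w1 by simp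
  hence wsum: "1 + w = - (w ^ 2)" by (simp add: eq_neg_iff_add_eq_0)
  have val: "\<exists>r. small r \<and> poly (p_poly d) (2 ^ s * v) = 2 ^ F * (v ^ (d - Suc k) * (1 + v) + r)"
    if v: "v \<in> V" for v
  proof -
    define e where "e l = B ^ l + (d - l) * s" for l
    have eF: "l = k \<or> l = Suc k \<Longrightarrow> e l = F" and eG: "l \<noteq> k \<Longrightarrow> l \<noteq> Suc k \<Longrightarrow> e l > F" if "l \<le> d" for l
      using term_exponent[OF B k that] by (simp_all add: e_def F_def s_def)
    define r where "r = (\<Sum>l\<in>{0..d}-{k, Suc k}. 2 ^ (e l - F) * v ^ (d - l))"
    have "small r"
      unfolding r_def
    proof (rule small_sum)
      fix l assume "l \<in> {0..d} - {k, Suc k}"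
      hence "e l > F" using eG by auto
      thus "small (2 ^ (e l - F) * v ^ (d - l))"
        by (intro small_mult small_power_2 power_mem v) simp
    qed
    have "poly (p_poly d) (2 ^ s * v) = (\<Sum>l=0..d. 2 ^ e l * v ^ (d - l))"
      unfolding poly_p_poly
      by (intro sum.cong refl)
         (simp add: e_def B_def power_add power_mult power_mult_distrib mult.commute[of "_ - _"])
    also have "\<dots> = (\<Sum>l\<in>{0..d}-{k, Suc k}. 2 ^ e l * v ^ (d - l)) + (\<Sum>l\<in>{k, Suc k}. 2 ^ e l * v ^ (d - l))"
      by (rule sum.subset_diff) (use k in auto)
    also have "(\<Sum>l\<in>{0..d}-{k, Suc k}. 2 ^ e l * v ^ (d - l)) = 2 ^ F * r"
      unfolding r_def sum_distrib_left
    proof (intro sum.cong refl)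
      fix l assume "l \<in> {0..d} - {k, Suc k}"
      hence "e l = F + (e l - F)" using eG[of l] by auto
      hence "(2::complex) ^ e l = 2 ^ F * 2 ^ (e l - F)" by (metis power_add)
      thus "2 ^ e l * v ^ (d - l) = 2 ^ F * (2 ^ (e l - F) * v ^ (d - l))" by simp
    qed
    also have "(\<Sum>l\<in>{k, Suc k}. 2 ^ e l * v ^ (d - l)) = 2 ^ F * (v ^ (d - Suc k) * (1 + v))"
    proof -
      have "d - k = Suc (d - Suc k)" using k by simp
      thus ?thesis using eF[of k] eF[of "Suc k"] k by (simp add: algebra_simps)
    qed
    finally show ?thesis using \<open>small r\<close> by (auto simp: algebra_simps)
  qed
  obtain r1 where r1: "small r1" "poly (p_poly d) (2 ^ s) = 2 ^ F * (2 + r1)"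
    using val[OF one_mem] by auto
  obtain r2 where r2: "small r2"
      "poly (p_poly d) (2 ^ s * w) = 2 ^ F * (w ^ (d - Suc k) * (1 + w) + r2)"
    using val[of w] wu by (auto simp: unit_def)
  have "\<not> unit (x / 2 ^ s)" if "poly (p_poly d) x = 0" for x
    using none that by (auto simp: s_def B_def)
  hence ratio: "poly (p_poly d) (2 ^ s) \<noteq> 0"
      "unit (poly (p_poly d) (2 ^ s * w) / poly (p_poly d) (2 ^ s))"
    using poly_ratio_unit[OF p_poly_nonzero, of "2 ^ s" w d] wu by auto
  define U where "U = w ^ (d - Suc k) * (1 + w) + r2"
  have "unit U"
    unfolding U_def wsum by (intro unit_add_small r2 unit_mult) (auto intro: unit_power wu)
  moreover have "unit (U / (2 + r1))" "2 + r1 \<noteq> 0" using ratio r1(2) r2(2) by (auto simp: U_def)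
  ultimately have "unit (U / (U / (2 + r1)))" using unit_divide by blast
  moreover have "U \<noteq> 0" using \<open>unit U\<close> by (simp add: unit_def)
  ultimately have "unit (2 + r1)" by simp
  moreover have "small (2 + r1)" by (intro small_add small_2 r1)
  ultimately show False by (simp add: small_def)
qed

end

lemma digits_unique:
  fixes a b :: "nat \<Rightarrow> nat"
  assumes "\<And>k. k < M \<Longrightarrow> a k < B" "\<And>k. k < M \<Longrightarrow> b k < B"
    and "(\<Sum>k<M. a k * B ^ k) = (\<Sum>k<M. b k * B ^ k)" and "k < M"
  shows "a k = b k"
  using assms
proof (induction M arbitrary: a b k)
  case (Suc M)
  have split: "(\<Sum>k<Suc M. f k * B ^ k) = f 0 + B * (\<Sum>k<M. f (Suc k) * B ^ k)" for f :: "nat \<Rightarrow> nat"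
    by (simp only: sum.lessThan_Suc_shift) (simp add: sum_distrib_left mult_ac)
  have eq: "a 0 + B * (\<Sum>k<M. a (Suc k) * B ^ k) = b 0 + B * (\<Sum>k<M. b (Suc k) * B ^ k)"
    using Suc.prems(3) unfolding split .
  have a0: "a 0 < B" "b 0 < B" using Suc.prems by auto
  have "a 0 = (a 0 + B * (\<Sum>k<M. a (Suc k) * B ^ k)) mod B" using a0 by simp
  also have "\<dots> = b 0" unfolding eq using a0 by simp
  finally have 0: "a 0 = b 0" .
  hence "(\<Sum>k<M. a (Suc k) * B ^ k) = (\<Sum>k<M. b (Suc k) * B ^ k)" using eq a0 by simp
  hence "a (Suc j) = b (Suc j)" if "j < M" for j
    using Suc.IH[of "\<lambda>k. a (Suc k)" "\<lambda>k. b (Suc k)" j] Suc.prems(1,2) that by auto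
  with 0 Suc.prems(4) show ?case by (cases k) auto
qed simp

context dyadic_valuation_ring
begin

text \<open>Numbers with pairwise distinct valuations have distinct subset sums: in the difference of two
  such sums, each coefficient is 0, 1 or -1, and the term of least valuation cannot cancel.\<close>

lemma subset_sums_distinct:
  fixes t :: "'i \<Rightarrow> complex" and n :: "'i \<Rightarrow> nat"
  assumes I: "finite I" and inj: "inj_on n I"
    and t: "\<And>i. i \<in> I \<Longrightarrow> unit (t i / 2 ^ n i)"
  shows "inj_on (\<lambda>A. \<Sum>i\<in>A. t i) (Pow I)"
proof (rule inj_onI, rule ccontr)
  fix A A' assume A: "A \<in> Pow I" "A' \<in> Pow I" and eq: "sum t A = sum t A'" and "A \<noteq> A'"
  define J where "J = (A - A') \<union> (A' - A)"
  have J: "J \<noteq> {}" "J \<subseteq> I" using A \<open>A \<noteq> A'\<close> by (auto simp: J_def)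
  have finJ: "finite J" by (rule finite_subset[OF J(2) I])
  define c where "c i = (if i \<in> A then 1 else -1 :: complex)" for i
  have fin: "finite A" "finite A'" using A I finite_subset by auto
  have "sum t A - sum t A' = (\<Sum>i\<in>A-A'. t i) - (\<Sum>i\<in>A'-A. t i)"
    using sum.Int_Diff[OF fin(1), of t A'] sum.Int_Diff[OF fin(2), of t A]
    unfolding Int_commute[of A' A] by simp
  also have "\<dots> = (\<Sum>i\<in>A-A'. c i * t i) + (\<Sum>i\<in>A'-A. c i * t i)"
    by (simp add: c_def sum_negf)
  also have "\<dots> = (\<Sum>i\<in>J. c i * t i)"
    unfolding J_def by (rule sum.union_disjoint[symmetric]) (use fin in auto)
  finally have sum0: "(\<Sum>i\<in>J. c i * t i) = 0" using eq by simp
  obtain j where j: "j \<in> J" "\<And>i. i \<in> J \<Longrightarrow> n j \<le> n i"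
    using arg_min_if_finite[OF finJ J(1), of n] that[of "arg_min_on n J"] by (auto simp: not_less)
  have "small (\<Sum>i\<in>J-{j}. c i * t i / 2 ^ n j)"
  proof (rule small_sum)
    fix i assume i: "i \<in> J - {j}"
    hence "n j \<noteq> n i" using inj J(2) j(1) by (auto simp: inj_on_def)
    hence lt: "n j < n i" using i j(2)[of i] by simp
    hence "c i * t i / 2 ^ n j = 2 ^ (n i - n j) * (c i * (t i / 2 ^ n i))"
      by (simp add: power_diff)
    moreover have "c i * (t i / 2 ^ n i) \<in> V"
      using t[of i] i J(2) by (intro mult_mem) (auto simp: c_def unit_def one_mem)
    ultimately show "small (c i * t i / 2 ^ n j)"
      using small_mult[OF small_power_2[of "n i - n j"]] lt by (simp only:)
  qed
  moreover have "unit (c j * t j / 2 ^ n j)"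
    using t[of j] j J(2) by (auto simp: c_def)
  ultimately have "unit (c j * t j / 2 ^ n j + (\<Sum>i\<in>J-{j}. c i * t i / 2 ^ n j))"
    by (rule unit_add_small[rotated])
  also have "c j * t j / 2 ^ n j + (\<Sum>i\<in>J-{j}. c i * t i / 2 ^ n j) = (\<Sum>i\<in>J. c i * t i / 2 ^ n j)"
    by (rule sum.remove[OF finJ j(1), symmetric])
  also have "\<dots> = 0" using sum0 by (simp flip: sum_divide_distrib)
  finally show False by (simp add: unit_def)
qed

end

text \<open>Roots \<open>\<xi> k\<close> of valuation \<open>(B - 1) B^k\<close>, where \<open>B = 2^d\<close>. The valuation of a monomial in
  these roots with exponents below \<open>B\<close> determines the exponents as its digits in base \<open>B\<close>.\<close>

lemma p_poly_roots_subset_sums: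
  assumes "d > 0"
  shows "\<exists>\<xi>. (\<forall>k<d. poly (p_poly d) (\<xi> k) = 0) \<and>
     (\<forall>M \<Delta>. M \<le> d \<longrightarrow> \<Delta> \<le> 2 ^ d \<longrightarrow>
        inj_on (\<lambda>A. \<Sum>\<alpha>\<in>A. \<Prod>k<M. \<xi> k ^ \<alpha> k) (Pow ({..<M} \<rightarrow>\<^sub>E {..<\<Delta>})))"
proof -
  obtain V where "dyadic_valuation_ring V" using ex_dyadic_valuation_ring by blast
  then interpret dyadic_valuation_ring V .
  define B :: nat where "B = 2 ^ d"
  have "\<forall>k. \<exists>x. k < d \<longrightarrow> poly (p_poly d) x = 0 \<and> unit (x / 2 ^ ((B - 1) * B ^ k))"
    using ex_root_of_valuation[of _ d] by (auto simp: B_def)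
  then obtain \<xi> where \<xi>: "\<And>k. k < d \<Longrightarrow> poly (p_poly d) (\<xi> k) = 0"
      "\<And>k. k < d \<Longrightarrow> unit (\<xi> k / 2 ^ ((B - 1) * B ^ k))" by metis
  have "inj_on (\<lambda>A. \<Sum>\<alpha>\<in>A. \<Prod>k<M. \<xi> k ^ \<alpha> k) (Pow ({..<M} \<rightarrow>\<^sub>E {..<\<Delta>}))"
    if M: "M \<le> d" and \<Delta>: "\<Delta> \<le> 2 ^ d" for M \<Delta>
  proof -
    have B: "B \<ge> 2" using \<open>d > 0\<close> unfolding B_def by (cases d) auto
    show ?thesis
    proof (rule subset_sums_distinct[where n = "\<lambda>\<alpha>. (B - 1) * (\<Sum>k<M. \<alpha> k * B ^ k)"])
      show "finite ({..<M} \<rightarrow>\<^sub>E {..<\<Delta>})" by (intro finite_PiE) auto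
    next
      show "inj_on (\<lambda>\<alpha>. (B - 1) * (\<Sum>k<M. \<alpha> k * B ^ k)) ({..<M} \<rightarrow>\<^sub>E {..<\<Delta>})"
      proof (rule inj_onI)
        fix \<alpha> \<beta> assume ab: "\<alpha> \<in> {..<M} \<rightarrow>\<^sub>E {..<\<Delta>}" "\<beta> \<in> {..<M} \<rightarrow>\<^sub>E {..<\<Delta>}"
          and "(B - 1) * (\<Sum>k<M. \<alpha> k * B ^ k) = (B - 1) * (\<Sum>k<M. \<beta> k * B ^ k)"
        hence eq: "(\<Sum>k<M. \<alpha> k * B ^ k) = (\<Sum>k<M. \<beta> k * B ^ k)" using B by simp
        have lt: "\<alpha> k < B" "\<beta> k < B" if "k < M" for k
        proof -
          have "\<alpha> k < \<Delta>" "\<beta> k < \<Delta>" using ab that by (auto simp: PiE_iff)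
          with \<Delta> show "\<alpha> k < B" "\<beta> k < B" by (auto simp: B_def)
        qed
        show "\<alpha> = \<beta>"
          by (rule PiE_ext[OF ab]) (use digits_unique[OF lt eq] in auto)
      qed
    next
      fix \<alpha> assume "\<alpha> \<in> {..<M} \<rightarrow>\<^sub>E {..<\<Delta>}"
      have "(\<Prod>k<M. \<xi> k ^ \<alpha> k) / 2 ^ ((B - 1) * (\<Sum>k<M. \<alpha> k * B ^ k)) =
          (\<Prod>k<M. (\<xi> k / 2 ^ ((B - 1) * B ^ k)) ^ \<alpha> k)"
        by (simp add: sum_distrib_left power_sum prod_dividef power_divide mult_ac flip: power_mult)
      also have "unit \<dots>" by (intro unit_prod unit_power \<xi>) (use M in auto)
      finally show "unit ((\<Prod>k<M. \<xi> k ^ \<alpha> k) / 2 ^ ((B - 1) * (\<Sum>k<M. \<alpha> k * B ^ k)))" .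
    qed
  qed
  with \<xi> show ?thesis by blast
qed

section \<open>Integer combinations of bounded weight\<close>

text \<open>\<open>isum B w y\<close>: the element \<open>y\<close> is an integer combination of elements of \<open>B\<close> whose
  coefficients have absolute values of sum at most \<open>w\<close>, written as a sum of at most \<open>w\<close> elements
  of \<open>B\<close> with signs.\<close>

inductive isum :: "'a :: ab_group_add set \<Rightarrow> nat \<Rightarrow> 'a \<Rightarrow> bool" for B where
  isum_zero: "isum B w 0"
| isum_add: "isum B w y \<Longrightarrow> b \<in> B \<Longrightarrow> isum B (Suc w) (y + b)"
| isum_diff: "isum B w y \<Longrightarrow> b \<in> B \<Longrightarrow> isum B (Suc w) (y - b)"

lemma isum_weaken: "isum B w y \<Longrightarrow> w \<le> w' \<Longrightarrow> isum B w' y"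
proof (induction arbitrary: w' rule: isum.induct)
  case (isum_add w y b)
  then show ?case using isum.isum_add[of B "w' - 1" y b] by (cases w') auto
next
  case (isum_diff w y b)
  then show ?case using isum.isum_diff[of B "w' - 1" y b] by (cases w') auto
qed (rule isum.isum_zero)

lemma isum_base: "b \<in> B \<Longrightarrow> isum B (Suc 0) b"
  using isum_add[OF isum_zero, of b B 0] by simp

lemma isum_plus: "isum B w y \<Longrightarrow> isum B w' y' \<Longrightarrow> isum B (w + w') (y' + y)"
proof (induction rule: isum.induct)
  case (isum_zero w)
  then show ?case using isum_weaken[of B w' y' "w + w'"] by simp
next
  case (isum_add w y b)
  then show ?case using isum.isum_add[of B "w + w'" "y' + y" b] by (simp add: add_ac)
next
  case (isum_diff w y b)
  then show ?case using isum.isum_diff[of B "w + w'" "y' + y" b] by (simp add: add_diff_eq)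
qed

lemma isum_uminus: "isum B w y \<Longrightarrow> isum B w (- y)"
proof (induction rule: isum.induct)
  case (isum_add w y b)
  then show ?case using isum.isum_diff[of B w "-y" b] by simp
next
  case (isum_diff w y b)
  then show ?case using isum.isum_add[of B w "-y" b] by simp
qed (auto intro: isum.isum_zero)

lemma isum_image:
  assumes "isum B w y"
    and add: "\<And>y z. f (y + z) = f y + f z"
    and base: "\<And>b. b \<in> B \<Longrightarrow> isum B' v (f b)"
  shows "isum B' (w * v) (f y)"
  using assms(1)
proof (induction rule: isum.induct)
  case (isum_zero w)
  have "f 0 = 0" using add[of 0 0] by simp
  then show ?case by (simp add: isum.isum_zero)
next
  case (isum_add w y b)
  then show ?case using isum_plus[OF isum_add.IH base] by (simp add: add add_ac)
next
  case (isum_diff w y b)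
  have "f (y - b) = f y - f b" using add[of "y - b" b] by simp
  then show ?case
    using isum_plus[OF isum_diff.IH isum_uminus[OF base[OF isum_diff.hyps(2)]]]
    by (simp add: add_ac)
qed

lemma isum_mult:
  fixes y y' :: "'a :: comm_ring_1"
  assumes "isum B w y" "isum B' w' y'"
    and "\<And>b b'. b \<in> B \<Longrightarrow> b' \<in> B' \<Longrightarrow> b * b' \<in> B''"
  shows "isum B'' (w * w') (y * y')"
proof (rule isum_image[OF assms(1), where f = "\<lambda>y. y * y'"])
  fix b assume b: "b \<in> B"
  have "isum B'' (w' * 1) (b * y')"
    by (rule isum_image[OF assms(2), where f = "\<lambda>z. b * z"])
       (auto simp: distrib_left intro: isum_base assms(3) b)
  thus "isum B'' w' (b * y')" by simp
qed (simp add: algebra_simps)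

lemma isum_mono: "isum B w y \<Longrightarrow> B \<subseteq> B' \<Longrightarrow> isum B' w y"
  by (induction rule: isum.induct) (auto intro: isum.intros)

lemma isum_sum:
  assumes "finite A" "\<And>a. a \<in> A \<Longrightarrow> isum B w (f a)"
  shows "isum B (card A * w) (sum f A)"
  using assms
proof (induction A rule: finite_induct)
  case (insert a A)
  then have "isum B (card A * w + w) (f a + sum f A)" by (intro isum_plus) auto
  with insert show ?case by (simp add: add_ac)
qed (auto intro: isum_zero)

lemma isum_coeffs:
  assumes "finite B" "isum B w (y :: 'a :: ring_1)"
  shows "\<exists>n \<in> B \<rightarrow>\<^sub>E {- int w..int w}. y = (\<Sum>b\<in>B. of_int (n b) * b)"
  using assms(2)
proof (induction rule: isum.induct)
  case (isum_zero w)
  show ?case by (rule bexI[of _ "\<lambda>b\<in>B. 0"]) auto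
next
  case (isum_add w y b)
  then obtain n where n: "n \<in> B \<rightarrow>\<^sub>E {- int w..int w}" "y = (\<Sum>b\<in>B. of_int (n b) * b)" by blast
  have *: "n x + 1 \<in> {- int (Suc w)..int (Suc w)}" "n x \<in> {- int (Suc w)..int (Suc w)}" if "x \<in> B" for x
    using PiE_mem[OF n(1) that] by auto
  show ?case
    by (rule bexI[of _ "n(b := n b + 1)"])
       (use n(1) isum_add.hyps * assms(1) in
        \<open>auto simp: n(2) sum.remove[of B b] algebra_simps PiE_iff extensional_def\<close>)
next
  case (isum_diff w y b)
  then obtain n where n: "n \<in> B \<rightarrow>\<^sub>E {- int w..int w}" "y = (\<Sum>b\<in>B. of_int (n b) * b)" by blast
  have *: "n x - 1 \<in> {- int (Suc w)..int (Suc w)}" "n x \<in> {- int (Suc w)..int (Suc w)}" if "x \<in> B" for x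
    using PiE_mem[OF n(1) that] by auto
  show ?case
    by (rule bexI[of _ "n(b := n b - 1)"])
       (use n(1) isum_diff.hyps * assms(1) in
        \<open>auto simp: n(2) sum.remove[of B b] algebra_simps PiE_iff extensional_def\<close>)
qed

lemma card_isum:
  assumes "finite B"
  shows "finite {y :: 'a :: ring_1. isum B w y}"
    and "card {y :: 'a. isum B w y} \<le> (2 * w + 1) ^ card B"
proof -
  let ?N = "B \<rightarrow>\<^sub>E {- int w..int w}"
  let ?f = "\<lambda>n. \<Sum>b\<in>B. of_int (n b) * (b :: 'a)"
  have sub: "{y. isum B w y} \<subseteq> ?f ` ?N" using isum_coeffs[OF assms] by blast
  have fin: "finite ?N" using assms by (intro finite_PiE) auto
  show "finite {y. isum B w y}" using finite_subset[OF sub] fin by blast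
  have "card {y. isum B w y} \<le> card (?f ` ?N)" using fin by (intro card_mono sub) auto
  also have "\<dots> \<le> card ?N" by (rule card_image_le[OF fin])
  also have "\<dots> = (2 * w + 1) ^ card B" using assms by (simp add: card_PiE nat_add_distrib nat_mult_distrib)
  finally show "card {y. isum B w y} \<le> (2 * w + 1) ^ card B" .
qed

text \<open>The values of the monomials in the family \<open>g\<close> with index set \<open>I\<close> whose exponents are at
  most \<open>N\<close>.\<close>

definition monomials :: "('i \<Rightarrow> 'a :: comm_monoid_mult) \<Rightarrow> 'i set \<Rightarrow> nat \<Rightarrow> 'a set" where
  "monomials g I N = (\<lambda>\<gamma>. \<Prod>i\<in>I. g i ^ \<gamma> i) ` (I \<rightarrow>\<^sub>E {..N})"

lemma monomialsI: "(\<And>i. i \<in> I \<Longrightarrow> \<gamma> i \<le> N) \<Longrightarrow> (\<Prod>i\<in>I. g i ^ \<gamma> i) \<in> monomials g I N"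
  unfolding monomials_def
  by (rule image_eqI[of _ _ "restrict \<gamma> I"]) (auto intro: prod.cong)

lemma monomialsD:
  "a \<in> monomials g I N \<Longrightarrow> \<exists>\<gamma>. a = (\<Prod>i\<in>I. g i ^ \<gamma> i) \<and> (\<forall>i\<in>I. \<gamma> i \<le> N)"
  unfolding monomials_def by (auto simp: PiE_iff)

lemma card_monomials:
  assumes "finite I"
  shows "finite (monomials g I N)" "card (monomials g I N) \<le> Suc N ^ card I"
proof -
  have fin: "finite (I \<rightarrow>\<^sub>E {..N})" using assms by (intro finite_PiE) auto
  thus "finite (monomials g I N)" by (simp add: monomials_def)
  have "card (monomials g I N) \<le> card (I \<rightarrow>\<^sub>E {..N})"
    unfolding monomials_def by (rule card_image_le[OF fin])
  also have "\<dots> = Suc N ^ card I" using assms by (simp add: card_PiE)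
  finally show "card (monomials g I N) \<le> Suc N ^ card I" .
qed

lemma one_mem_monomials: "1 \<in> monomials g I N"
  using monomialsI[of I "\<lambda>_. 0" N g] by simp

lemma mult_mem_monomials:
  assumes "a \<in> monomials g I N" "b \<in> monomials g I N'"
  shows "a * b \<in> monomials g I (N + N')"
proof -
  obtain \<gamma> where "a = (\<Prod>i\<in>I. g i ^ \<gamma> i)" "\<And>i. i \<in> I \<Longrightarrow> \<gamma> i \<le> N"
    using monomialsD[OF assms(1)] by blast
  moreover obtain \<gamma>' where "b = (\<Prod>i\<in>I. g i ^ \<gamma>' i)" "\<And>i. i \<in> I \<Longrightarrow> \<gamma>' i \<le> N'"
    using monomialsD[OF assms(2)] by blast
  ultimately show ?thesis
    using monomialsI[of I "\<lambda>i. \<gamma> i + \<gamma>' i" "N + N'" g] by (simp add: prod.distrib power_add add_mono)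
qed

lemma monomials_mono:
  assumes "finite I'" "I \<subseteq> I'" "N \<le> N'"
  shows "monomials g I N \<subseteq> monomials g I' N'"
proof
  fix a assume "a \<in> monomials g I N"
  then obtain \<gamma> where \<gamma>: "a = (\<Prod>i\<in>I. g i ^ \<gamma> i)" "\<And>i. i \<in> I \<Longrightarrow> \<gamma> i \<le> N"
    using monomialsD by blast
  define \<gamma>' where "\<gamma>' i = (if i \<in> I then \<gamma> i else 0)" for i
  have "a = (\<Prod>i\<in>I'. g i ^ \<gamma>' i)"
    unfolding \<gamma>(1) by (rule prod.mono_neutral_cong_left) (use assms in \<open>auto simp: \<gamma>'_def\<close>)
  also have "\<dots> \<in> monomials g I' N'"
    by (rule monomialsI) (use \<gamma>(2) assms(3) order_trans in \<open>auto simp: \<gamma>'_def\<close>)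
  finally show "a \<in> monomials g I' N'" .
qed

lemma generator_mem_monomials:
  assumes "finite I" "i \<in> I" "N \<ge> 1"
  shows "g i \<in> monomials g I N"
proof -
  have "g i = (\<Prod>j\<in>I. g j ^ (if j = i then 1 else 0))"
    using assms by (simp add: if_distrib prod.delta cong: if_cong)
  also have "\<dots> \<in> monomials g I N" by (rule monomialsI) (use assms in auto)
  finally show ?thesis .
qed

text \<open>The exponent of a single generator can be changed freely below the bound.\<close>

lemma update_mem_monomials:
  assumes "finite I" "i \<in> I" "b \<in> monomials g I N"
  obtains \<beta> c where "b = g i ^ \<beta> * c" "\<beta> \<le> N" "\<And>j. j \<le> N \<Longrightarrow> g i ^ j * c \<in> monomials g I N"
proof -
  obtain \<gamma> where \<gamma>: "b = (\<Prod>i\<in>I. g i ^ \<gamma> i)" "\<And>i. i \<in> I \<Longrightarrow> \<gamma> i \<le> N"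
    using monomialsD[OF assms(3)] by blast
  define c where "c = (\<Prod>k\<in>I-{i}. g k ^ \<gamma> k)"
  have "b = g i ^ \<gamma> i * c" unfolding \<gamma>(1) c_def by (rule prod.remove) (use assms in auto)
  moreover have "g i ^ j * c \<in> monomials g I N" if "j \<le> N" for j
  proof -
    have "g i ^ j * c = (\<Prod>k\<in>I. g k ^ (\<gamma>(i := j)) k)"
      unfolding c_def using assms(1,2) by (subst prod.remove[of I i]) (auto intro: prod.cong)
    also have "\<dots> \<in> monomials g I N" by (rule monomialsI) (use \<gamma>(2) that in auto)
    finally show ?thesis .
  qed
  ultimately show ?thesis using that \<gamma>(2)[OF assms(2)] by blast
qed

text \<open>Monomials \<open>a X^j\<close>, where \<open>a\<close> is itself a monomial in the numbers \<open>K\<close>. Their integer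
  combinations are the polynomials in \<open>X\<close> over the ring generated by \<open>K\<close>.\<close>

definition poly_monomials :: "complex set \<Rightarrow> nat \<Rightarrow> complex poly set" where
  "poly_monomials K N = {monom a j | a j. a \<in> monomials id K N \<and> j \<le> N}"

lemma mult_mem_poly_monomials:
  "f \<in> poly_monomials K N \<Longrightarrow> g \<in> poly_monomials K N' \<Longrightarrow> f * g \<in> poly_monomials K (N + N')"
  unfolding poly_monomials_def by (fastforce simp: mult_monom intro: mult_mem_monomials)

lemma poly_monomials_mono:
  "finite K' \<Longrightarrow> K \<subseteq> K' \<Longrightarrow> N \<le> N' \<Longrightarrow> poly_monomials K N \<subseteq> poly_monomials K' N'"
  unfolding poly_monomials_def using monomials_mono[of K' K N N' id] by fastforce

lemma isum_poly_monomials_degree: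
  assumes "isum (poly_monomials K N) w Q"
  shows "degree Q \<le> N"
  using assms
proof (induction rule: isum.induct)
  case (isum_add w y b)
  then show ?case
    by (intro degree_add_le) (auto simp: poly_monomials_def intro: degree_monom_le order_trans)
next
  case (isum_diff w y b)
  then show ?case
    by (intro degree_diff_le) (auto simp: poly_monomials_def intro: degree_monom_le order_trans)
qed auto

section \<open>Subset sums of monomials in roots of a common polynomial\<close>

text \<open>Products of a monomial in the numbers \<open>K\<close> with exponents at most \<open>n\<close> and a monomial in the
  \<open>\<xi> i\<close> with exponents less than \<open>e\<close>. For roots \<open>\<xi> i\<close> of a polynomial of degree \<open>e\<close> over the
  ring generated by \<open>K\<close>, these span all monomials in the \<open>\<xi> i\<close> up to powers of the leading
  coefficient.\<close>

definition reduced_products :: "complex set \<Rightarrow> ('i \<Rightarrow> complex) \<Rightarrow> 'i set \<Rightarrow> nat \<Rightarrow> nat \<Rightarrow> complex set" where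
  "reduced_products K \<xi> I n e = {a * b | a b. a \<in> monomials id K n \<and> b \<in> monomials \<xi> I (e - 1)}"

lemma reduced_productsI:
  "a \<in> monomials id K n \<Longrightarrow> b \<in> monomials \<xi> I (e - 1) \<Longrightarrow> a * b \<in> reduced_products K \<xi> I n e"
  by (auto simp: reduced_products_def)

lemma card_reduced_products:
  assumes "finite K" "finite I" "e > 0"
  shows "finite (reduced_products K \<xi> I n e)"
    and "card (reduced_products K \<xi> I n e) \<le> Suc n ^ card K * e ^ card I"
proof -
  let ?A = "monomials id K n" and ?B = "monomials \<xi> I (e - 1)"
  have eq: "reduced_products K \<xi> I n e = (\<lambda>(a, b). a * b) ` (?A \<times> ?B)"
    by (auto simp: reduced_products_def)
  have fin: "finite (?A \<times> ?B)" by (intro finite_cartesian_product card_monomials assms)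
  show "finite (reduced_products K \<xi> I n e)" unfolding eq using fin by auto
  have "card (reduced_products K \<xi> I n e) \<le> card (?A \<times> ?B)"
    unfolding eq by (rule card_image_le[OF fin])
  also have "\<dots> = card ?A * card ?B" by (simp add: card_cartesian_product)
  also have "\<dots> \<le> Suc n ^ card K * e ^ card I"
    using card_monomials(2)[OF assms(1), of id n] card_monomials(2)[OF assms(2), of \<xi> "e - 1"] assms(3)
    by (intro mult_mono) auto
  finally show "card (reduced_products K \<xi> I n e) \<le> Suc n ^ card K * e ^ card I" .
qed

context
  fixes Q :: "complex poly" and K :: "complex set" and N W :: nat
    and \<xi> :: "'i \<Rightarrow> complex" and I :: "'i set"
  assumes K: "finite K" and I: "finite I"
    and Q: "isum (poly_monomials K N) W Q" "Q \<noteq> 0" "degree Q > 0"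
    and root: "\<And>i. i \<in> I \<Longrightarrow> poly Q (\<xi> i) = 0"
begin

abbreviation (input) "lc \<equiv> coeff Q (degree Q)"
abbreviation (input) "red n \<equiv> reduced_products K \<xi> I n (degree Q)"

lemma isum_lead_coeff_mult:
  assumes "b \<in> red n"
  shows "isum (red (n + N)) W (lc * b)"
proof -
  obtain a c where b: "b = a * c" "a \<in> monomials id K n" "c \<in> monomials \<xi> I (degree Q - 1)"
    using assms by (auto simp: reduced_products_def)
  have "isum (red (n + N)) (W * 1) (coeff Q (degree Q) * b)"
  proof (rule isum_image[OF Q(1), where f = "\<lambda>F. coeff F (degree Q) * b"])
    fix f assume "f \<in> poly_monomials K N"
    then obtain a' j where f: "f = monom a' j" "a' \<in> monomials id K N"
      by (auto simp: poly_monomials_def)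
    show "isum (red (n + N)) 1 (coeff f (degree Q) * b)"
    proof (cases "j = degree Q")
      case True
      have "a' * b \<in> red (n + N)"
        using reduced_productsI[OF mult_mem_monomials[OF b(2) f(2)] b(3)]
        by (simp add: b(1) mult_ac)
      thus ?thesis using True by (simp add: f isum_base)
    qed (simp add: f isum_zero)
  qed (simp add: algebra_simps)
  thus ?thesis by simp
qed

text \<open>Multiplication by a root times the leading coefficient. When the exponent of the root would
  reach the degree, the equation \<open>Q(\<xi> i) = 0\<close> is used to lower it. The weight \<open>W\<close> counts all
  terms of \<open>Q\<close> together, so that also in this case the weight grows only by the factor \<open>W\<close>.\<close>

lemma isum_lead_coeff_root_mult:
  assumes b: "b \<in> red n" and i: "i \<in> I"
  shows "isum (red (n + N)) W (lc * \<xi> i * b)"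
proof -
  define e where "e = degree Q"
  obtain a c where ac: "b = a * c" "a \<in> monomials id K n" "c \<in> monomials \<xi> I (e - 1)"
    using b by (auto simp: reduced_products_def e_def)
  obtain \<beta> c' where c': "c = \<xi> i ^ \<beta> * c'" "\<beta> \<le> e - 1"
      "\<And>j. j \<le> e - 1 \<Longrightarrow> \<xi> i ^ j * c' \<in> monomials \<xi> I (e - 1)"
    using update_mem_monomials[OF I i ac(3)] by metis
  have e: "e > 0" using Q(3) by (simp add: e_def)
  show ?thesis
  proof (cases "Suc \<beta> \<le> e - 1")
    case True
    have "\<xi> i * b \<in> red n"
      using reduced_productsI[OF ac(2) c'(3)[OF True]] by (simp add: ac(1) c'(1) mult_ac e_def)
    from isum_lead_coeff_mult[OF this] show ?thesis by (simp add: mult_ac)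
  next
    case False
    hence \<beta>: "Suc \<beta> = e" using c'(2) e by simp
    have "0 = (\<Sum>j\<le>e. coeff Q j * \<xi> i ^ j)"
      using root[OF i] by (simp add: poly_altdef e_def)
    also have "\<dots> = (\<Sum>j<e. coeff Q j * \<xi> i ^ j) + lc * \<xi> i ^ e"
      by (simp add: lessThan_Suc_atMost[symmetric] e_def)
    finally have "lc * \<xi> i ^ e = - (\<Sum>j<e. coeff Q j * \<xi> i ^ j)"
      by (simp add: eq_neg_iff_add_eq_0 add.commute)
    moreover have "lc * \<xi> i * b = (lc * \<xi> i ^ e) * (a * c')"
      by (simp add: ac(1) c'(1) mult_ac flip: \<beta>)
    ultimately have eq: "lc * \<xi> i * b = - ((\<Sum>j<e. coeff Q j * \<xi> i ^ j) * (a * c'))" by simp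
    have "isum (red (n + N)) (W * 1) ((\<Sum>j<e. coeff Q j * \<xi> i ^ j) * (a * c'))"
    proof (rule isum_image[OF Q(1), where f = "\<lambda>F. (\<Sum>j<e. coeff F j * \<xi> i ^ j) * (a * c')"])
      fix f assume "f \<in> poly_monomials K N"
      then obtain a' k where f: "f = monom a' k" "a' \<in> monomials id K N"
        by (auto simp: poly_monomials_def)
      show "isum (red (n + N)) 1 ((\<Sum>j<e. coeff f j * \<xi> i ^ j) * (a * c'))"
      proof (cases "k < e")
        case True
        have "(\<Sum>j<e. coeff f j * \<xi> i ^ j) = (\<Sum>j<e. if j = k then a' * \<xi> i ^ j else 0)"
          by (intro sum.cong) (auto simp: f)
        also have "\<dots> = a' * \<xi> i ^ k" using True by simp
        finally have "(\<Sum>j<e. coeff f j * \<xi> i ^ j) * (a * c') = (a * a') * (\<xi> i ^ k * c')"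
          by (simp add: mult_ac)
        moreover have "\<dots> \<in> red (n + N)"
          using True reduced_productsI[OF mult_mem_monomials[OF ac(2) f(2)] c'(3)[of k]]
          by (simp add: e_def)
        ultimately show ?thesis by (simp only: isum_base One_nat_def)
      next
        case False
        hence "(\<Sum>j<e. coeff f j * \<xi> i ^ j) = 0" by (intro sum.neutral) (auto simp: f)
        thus ?thesis by (simp add: isum_zero)
      qed
    qed (simp add: algebra_simps sum.distrib)
    thus ?thesis unfolding eq by (simp add: isum_uminus)
  qed
qed

lemma isum_mult_iterate:
  assumes step: "\<And>n b. b \<in> red n \<Longrightarrow> isum (red (n + N)) W (z * b)"
    and "isum (red n) w y"
  shows "isum (red (n + k * N)) (w * W ^ k) (z ^ k * y)"
proof (induction k)
  case (Suc k)
  have "isum (red (n + k * N + N)) (w * W ^ k * W) (z * (z ^ k * y))"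
    by (rule isum_image[OF Suc, where f = "\<lambda>y. z * y"]) (auto intro: step simp: distrib_left)
  thus ?case by (simp add: mult_ac add_ac)
qed (use assms in simp)

lemma isum_scaled_monomial:
  assumes "J \<subseteq> I" "\<And>i. i \<in> J \<Longrightarrow> \<alpha> i \<le> \<Delta>"
  shows "isum (red (card J * \<Delta> * N)) (W ^ (card J * \<Delta>))
           (lc ^ (card J * \<Delta>) * (\<Prod>i\<in>J. \<xi> i ^ \<alpha> i))"
  using finite_subset[OF assms(1) I] assms
proof (induction J rule: finite_induct)
  case empty
  have "1 \<in> red 0" using reduced_productsI[OF one_mem_monomials one_mem_monomials] by simp
  then show ?case by (simp add: isum_base)
next
  case (insert i J)
  let ?y = "lc ^ (card J * \<Delta>) * (\<Prod>i\<in>J. \<xi> i ^ \<alpha> i)"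
  let ?n = "card J * \<Delta> * N" and ?w = "W ^ (card J * \<Delta>)"
  have le: "\<alpha> i \<le> \<Delta>" using insert.prems by simp
  have 1: "isum (red (?n + \<alpha> i * N)) (?w * W ^ \<alpha> i) ((lc * \<xi> i) ^ \<alpha> i * ?y)"
    by (rule isum_mult_iterate)
       (use insert isum_lead_coeff_root_mult[of _ _ i] in auto)
  have 2: "isum (red (?n + \<alpha> i * N + (\<Delta> - \<alpha> i) * N)) (?w * W ^ \<alpha> i * W ^ (\<Delta> - \<alpha> i))
      (lc ^ (\<Delta> - \<alpha> i) * ((lc * \<xi> i) ^ \<alpha> i * ?y))"
    by (rule isum_mult_iterate[OF isum_lead_coeff_mult 1])
  have "?n + \<alpha> i * N + (\<Delta> - \<alpha> i) * N = card (insert i J) * \<Delta> * N"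
  proof -
    have "?n + \<alpha> i * N + (\<Delta> - \<alpha> i) * N = (card J * \<Delta> + (\<alpha> i + (\<Delta> - \<alpha> i))) * N"
      by (simp only: add_mult_distrib add.assoc)
    thus ?thesis using insert.hyps le by simp
  qed
  moreover have "?w * W ^ \<alpha> i * W ^ (\<Delta> - \<alpha> i) = W ^ (card (insert i J) * \<Delta>)"
    using insert.hyps le by (simp add: mult.assoc add_ac flip: power_add)
  moreover have "lc ^ (\<Delta> - \<alpha> i) * ((lc * \<xi> i) ^ \<alpha> i * ?y) =
      lc ^ (card (insert i J) * \<Delta>) * (\<Prod>i\<in>insert i J. \<xi> i ^ \<alpha> i)"
  proof -
    have "lc ^ \<Delta> = lc ^ (\<Delta> - \<alpha> i) * lc ^ \<alpha> i" using le by (simp flip: power_add)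
    thus ?thesis using insert.hyps by (simp add: power_mult_distrib power_add mult_ac)
  qed
  ultimately show ?case using 2 by simp
qed

text \<open>The pigeonhole argument. There are \<open>2 ^ (\<Delta> ^ card I)\<close> subsets of the monomials in the roots with
  exponents below \<open>\<Delta>\<close>, but their sums, scaled by a power of the leading coefficient, are integer
  combinations of small weight of the few elements of \<open>reduced_products\<close>.\<close>

lemma subset_sums_collide:
  assumes count: "(2 * (\<Delta> ^ card I * W ^ (card I * \<Delta>)) + 1)
      ^ (Suc (card I * \<Delta> * N) ^ card K * degree Q ^ card I) < 2 ^ (\<Delta> ^ card I)"
  shows "\<not> inj_on (\<lambda>A. \<Sum>\<alpha>\<in>A. \<Prod>i\<in>I. \<xi> i ^ \<alpha> i) (Pow (I \<rightarrow>\<^sub>E {..<\<Delta>}))"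
proof
  assume inj: "inj_on (\<lambda>A. \<Sum>\<alpha>\<in>A. \<Prod>i\<in>I. \<xi> i ^ \<alpha> i) (Pow (I \<rightarrow>\<^sub>E {..<\<Delta>}))"
  define P where "P = I \<rightarrow>\<^sub>E {..<\<Delta>}"
  define n where "n = card I * \<Delta> * N"
  define w where "w = \<Delta> ^ card I * W ^ (card I * \<Delta>)"
  define \<sigma> where "\<sigma> A = lc ^ (card I * \<Delta>) * (\<Sum>\<alpha>\<in>A. \<Prod>i\<in>I. \<xi> i ^ \<alpha> i)" for A
  have P: "finite P" "card P = \<Delta> ^ card I" using I by (simp_all add: P_def card_PiE finite_PiE)
  have "lc ^ (card I * \<Delta>) \<noteq> 0" using Q(2) by simp
  hence inj': "inj_on \<sigma> (Pow P)"
    using inj by (simp only: \<sigma>_def P_def inj_on_def mult_left_cancel simp_thms)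
  have "isum (red n) w (\<sigma> A)" if A: "A \<in> Pow P" for A
  proof -
    have "isum (red n) (card A * W ^ (card I * \<Delta>)) (\<Sum>\<alpha>\<in>A. lc ^ (card I * \<Delta>) * (\<Prod>i\<in>I. \<xi> i ^ \<alpha> i))"
    proof (rule isum_sum)
      show "finite A" using A P(1) by (auto intro: finite_subset)
      fix \<alpha> assume "\<alpha> \<in> A"
      hence "\<alpha> \<in> P" using A by auto
      hence "\<alpha> i \<le> \<Delta>" if "i \<in> I" for i
        using PiE_mem[of \<alpha> I "\<lambda>_. {..<\<Delta>}" i] that unfolding P_def by simp
      thus "isum (red n) (W ^ (card I * \<Delta>)) (lc ^ (card I * \<Delta>) * (\<Prod>i\<in>I. \<xi> i ^ \<alpha> i))"
        unfolding n_def by (intro isum_scaled_monomial) auto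
    qed
    moreover have "card A \<le> \<Delta> ^ card I" using card_mono[OF P(1), of A] A P(2) by simp
    ultimately show ?thesis
      unfolding \<sigma>_def w_def sum_distrib_left by (rule isum_weaken[OF _ mult_right_mono]) simp
  qed
  hence sub: "\<sigma> ` Pow P \<subseteq> {y. isum (red n) w y}" by blast
  note R = card_reduced_products[OF K I Q(3), of \<xi> n]
  have "2 ^ (\<Delta> ^ card I) = card (\<sigma> ` Pow P)"
    using card_image[OF inj'] P by (simp add: card_Pow)
  also have "\<dots> \<le> card {y. isum (red n) w y}"
    by (intro card_mono sub card_isum R)
  also have "\<dots> \<le> (2 * w + 1) ^ card (red n)"
    by (intro card_isum R)
  also have "\<dots> \<le> (2 * w + 1) ^ (Suc n ^ card K * degree Q ^ card I)"
    by (intro power_increasing R) simp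
  finally show False using count unfolding n_def w_def by (rule leD[THEN notE])
qed

end

section \<open>The generic path of a decision tree\<close>

text \<open>A bound for the polynomials that occur in a computation: degree and exponents of the constants
  are at most \<open>2^n\<close>, and \<open>2^(2^n - 1)\<close> bounds the sum of the absolute values of the coefficients.
  The exponent \<open>2^n - 1\<close> is chosen so that a sum of two products of polynomials at level \<open>n\<close> is
  at level \<open>n + 1\<close>.\<close>

definition at_level :: "complex set \<Rightarrow> nat \<Rightarrow> complex poly set" where
  "at_level K n = {F. isum (poly_monomials K (2 ^ n)) (2 ^ (2 ^ n - 1)) F}"

lemma at_level_mono:
  assumes "finite K'" "K \<subseteq> K'" "n \<le> n'"
  shows "at_level K n \<subseteq> at_level K' n'"
proof
  fix F assume "F \<in> at_level K n"
  hence "isum (poly_monomials K (2 ^ n)) (2 ^ (2 ^ n - 1)) F" by (simp add: at_level_def)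
  hence "isum (poly_monomials K' (2 ^ n')) (2 ^ (2 ^ n - 1)) F"
    using assms by (elim isum_mono) (intro poly_monomials_mono, auto)
  moreover have "(2::nat) ^ (2 ^ n - 1) \<le> 2 ^ (2 ^ n' - 1)"
    using assms(3) by (intro power_increasing diff_le_mono) auto
  ultimately show "F \<in> at_level K' n'" by (simp add: at_level_def isum_weaken)
qed

lemma at_level_input: "[:0, 1:] \<in> at_level K n"
proof -
  have "[:0, 1:] \<in> poly_monomials K (2 ^ n)"
    using one_mem_monomials[of id K "2 ^ n"]
    by (auto simp: poly_monomials_def monom_altdef intro!: exI[of _ 1])
  from isum_weaken[OF isum_base[OF this]] show ?thesis by (simp add: at_level_def)
qed

lemma at_level_const:
  assumes "finite K" "c \<in> insert 1 K"
  shows "[:c:] \<in> at_level K n"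
proof -
  have "c \<in> monomials id K (2 ^ n)"
    using generator_mem_monomials[OF assms(1), of c "2 ^ n" id] one_mem_monomials[of id K "2 ^ n"]
      assms(2) by auto
  hence "[:c:] \<in> poly_monomials K (2 ^ n)"
    by (auto simp: poly_monomials_def simp flip: monom_0)
  from isum_weaken[OF isum_base[OF this]] show ?thesis by (simp add: at_level_def)
qed

lemma isum_product_at_level:
  assumes "F \<in> at_level K n" "G \<in> at_level K n"
  shows "isum (poly_monomials K (2 ^ Suc n)) (2 ^ (2 ^ Suc n - 2)) (F * G)"
proof -
  have "(2::nat) ^ n \<ge> 1" by simp
  hence "(2 ^ n - 1) + (2 ^ n - 1) = 2 ^ Suc n - (2::nat)" by simp
  hence "(2::nat) ^ (2 ^ n - 1) * 2 ^ (2 ^ n - 1) = 2 ^ (2 ^ Suc n - 2)"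
    by (simp only: flip: power_add)
  moreover have "(2::nat) ^ n + 2 ^ n = 2 ^ Suc n" by simp
  hence "f * g \<in> poly_monomials K (2 ^ Suc n)"
    if "f \<in> poly_monomials K (2 ^ n)" "g \<in> poly_monomials K (2 ^ n)" for f g
    using mult_mem_poly_monomials[OF that] by (simp only:)
  ultimately show ?thesis
    using isum_mult[of "poly_monomials K (2 ^ n)" "2 ^ (2 ^ n - 1)" F
        "poly_monomials K (2 ^ n)" "2 ^ (2 ^ n - 1)" G "poly_monomials K (2 ^ Suc n)"] assms
    unfolding at_level_def mem_Collect_eq by (simp only: simp_thms)
qed

lemma at_level_mult:
  "F \<in> at_level K n \<Longrightarrow> G \<in> at_level K n \<Longrightarrow> F * G \<in> at_level K (Suc n)"
  unfolding at_level_def[of K "Suc n"] mem_Collect_eq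
  by (rule isum_weaken[OF isum_product_at_level]) (auto intro!: power_increasing)

lemma at_level_add_mult:
  assumes "F \<in> at_level K n" "G \<in> at_level K n" "F' \<in> at_level K n" "G' \<in> at_level K n"
  shows "F * G + F' * G' \<in> at_level K (Suc n)" "F * G - F' * G' \<in> at_level K (Suc n)"
proof -
  have "(2::nat) ^ Suc n \<ge> 2" by simp
  hence "2 ^ Suc n - (1::nat) = Suc (2 ^ Suc n - 2)" by linarith
  hence e: "(2::nat) ^ (2 ^ Suc n - 2) + 2 ^ (2 ^ Suc n - 2) = 2 ^ (2 ^ Suc n - 1)"
    by (simp only: power_Suc)
  note FG = isum_product_at_level[OF assms(1,2)] and FG' = isum_product_at_level[OF assms(3,4)]
  show "F * G + F' * G' \<in> at_level K (Suc n)" "F * G - F' * G' \<in> at_level K (Suc n)"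
    using isum_plus[OF FG' FG] isum_plus[OF isum_uminus[OF FG'] FG]
    unfolding at_level_def e by auto
qed

text \<open>Rational functions of the input, as pairs of a numerator and a denominator that are not reduced
  to lowest terms.\<close>

type_synonym fraction = "complex poly \<times> complex poly"

definition value_at :: "complex \<Rightarrow> fraction \<Rightarrow> complex" where
  "value_at x f = poly (fst f) x / poly (snd f) x"

fun combine :: "arith_op \<Rightarrow> fraction \<Rightarrow> fraction \<Rightarrow> fraction" where
  "combine Add (P, R) (P', R') = (P * R' + P' * R, R * R')"
| "combine Sub (P, R) (P', R') = (P * R' - P' * R, R * R')"
| "combine Mul (P, R) (P', R') = (P * P', R * R')"
| "combine Div (P, R) (P', R') = (P * R', R * P')"

fun operand_fraction :: "fraction list \<Rightarrow> tree_operand \<Rightarrow> fraction" where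
  "operand_fraction fs Input = ([:0, 1:], [:1:])"
| "operand_fraction fs (Const c) = ([:c:], [:1:])"
| "operand_fraction fs (Result k) = fs ! k"

fun operand_consts :: "tree_operand \<Rightarrow> complex set" where
  "operand_consts (Const c) = {c}"
| "operand_consts _ = {}"

definition good_fraction :: "complex set \<Rightarrow> nat \<Rightarrow> fraction \<Rightarrow> bool" where
  "good_fraction K n f \<longleftrightarrow> fst f \<in> at_level K n \<and> snd f \<in> at_level K n \<and> snd f \<noteq> 0"

lemma good_fraction_mono:
  "good_fraction K n f \<Longrightarrow> finite K' \<Longrightarrow> K \<subseteq> K' \<Longrightarrow> n \<le> n' \<Longrightarrow> good_fraction K' n' f"
  using at_level_mono unfolding good_fraction_def by blast

lemma good_operand_fraction:
  assumes "finite K" "\<forall>f\<in>set fs. good_fraction K n f" "wf_operand (length fs) u"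
    and "operand_consts u \<subseteq> K"
  shows "good_fraction K n (operand_fraction fs u)"
proof (cases u)
  case (Result k)
  with assms show ?thesis by auto
qed (use assms in \<open>auto simp: good_fraction_def intro!: at_level_input at_level_const\<close>)

lemma operand_fraction_value:
  assumes "wf_operand (length fs) u" "\<forall>f\<in>set fs. poly (snd f) x \<noteq> 0"
  shows "operand_value x (map (value_at x) fs) u = value_at x (operand_fraction fs u)"
    and "poly (snd (operand_fraction fs u)) x \<noteq> 0"
  using assms by (cases u; simp add: value_at_def)+

lemma good_combine:
  assumes "good_fraction K n f" "good_fraction K n g" and "op = Div \<longrightarrow> fst g \<noteq> 0"
  shows "good_fraction K (Suc n) (combine op f g)"
  using assms
  by (cases f; cases g; cases op)
     (auto simp: good_fraction_def intro: at_level_mult at_level_add_mult)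

lemma combine_value:
  assumes "poly (snd f) x \<noteq> 0" "poly (snd g) x \<noteq> 0" "op = Div \<longrightarrow> poly (fst g) x \<noteq> 0"
  shows "arith op (value_at x f) (value_at x g) = Some (value_at x (combine op f g))"
    and "poly (snd (combine op f g)) x \<noteq> 0"
  using assms
  by (cases f; cases g; cases op; simp add: value_at_def field_simps)+

text \<open>Along the path on which every result that is not identically zero tests as nonzero, all
  inputs see the same outcome \<open>r\<close>, except for the roots of one polynomial \<open>Q\<close>: the product of the
  nonzero numerators that are tested or divided by on this path. The outcome \<open>None\<close> stands for a
  path that ends in a division by a result that is identically zero. To \<open>K\<close>, the set \<open>K'\<close> adds
  the constants of this path only, as those of the whole tree can be exponentially many.\<close>

lemma generic_path:
  assumes "wf_tree (length fs) t" "finite K" "\<forall>f\<in>set fs. good_fraction K n f"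
  shows "\<exists>K' Q r. finite K' \<and> K \<subseteq> K' \<and> card K' \<le> card K + 2 * tree_depth t \<and>
           Q \<in> at_level K' (n + 2 * tree_depth t) \<and> Q \<noteq> 0 \<and>
           (\<forall>x. (\<forall>f\<in>set fs. poly (snd f) x \<noteq> 0) \<longrightarrow> poly Q x \<noteq> 0 \<longrightarrow>
              run_tree x (map (value_at x) fs) t = r)"
  using assms
proof (induction t arbitrary: fs K n)
  case (Leaf b)
  have "[:1:] \<in> at_level K n" using Leaf by (intro at_level_const) auto
  with Leaf show ?case
    by (intro exI[of _ K] exI[of _ "[:1:]"] exI[of _ "Some b"]) auto
next
  case (Arith op u v t)
  define K1 where "K1 = K \<union> (operand_consts u \<union> operand_consts v)"
  define f where "f = operand_fraction fs u"
  define g where "g = operand_fraction fs v"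
  have few: "finite (operand_consts w)" "card (operand_consts w) \<le> 1" for w
    by (cases w; simp)+
  have K1: "finite K1" "K \<subseteq> K1" "card K1 \<le> card K + 2"
    using Arith.prems(2) few[of u] few[of v]
      card_Un_le[of K "operand_consts u \<union> operand_consts v"]
      card_Un_le[of "operand_consts u" "operand_consts v"]
    unfolding K1_def by simp_all
  have good: "\<forall>f\<in>set fs. good_fraction K1 n f"
    using Arith.prems(3) K1 good_fraction_mono by blast
  have fg: "good_fraction K1 n f" "good_fraction K1 n g"
    unfolding f_def g_def using Arith.prems(1) good K1(1)
    by (auto intro!: good_operand_fraction simp: K1_def)
  show ?case
  proof (cases "op = Div \<and> fst g = 0")
    case True
    have "run_tree x (map (value_at x) fs) (Arith op u v t) = None"
      if "\<forall>f\<in>set fs. poly (snd f) x \<noteq> 0" for x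
      using True operand_fraction_value(1)[of fs v x] that Arith.prems(1)
      by (simp add: g_def value_at_def)
    moreover have "[:1:] \<in> at_level K (n + 2 * tree_depth (Arith op u v t))"
      using Arith.prems(2) by (intro at_level_const) auto
    ultimately show ?thesis using Arith.prems(2)
      by (intro exI[of _ K] exI[of _ "[:1:]"] exI[of _ None]) auto
  next
    case False
    define h where "h = combine op f g"
    have h: "good_fraction K1 (Suc n) h" unfolding h_def using fg False by (intro good_combine) auto
    have "\<forall>f\<in>set (fs @ [h]). good_fraction K1 (Suc n) f"
      using h good good_fraction_mono[OF _ K1(1) subset_refl, of n _ "Suc n"] by auto
    then obtain K' Q r where IH: "finite K'" "K1 \<subseteq> K'" "card K' \<le> card K1 + 2 * tree_depth t"
      "Q \<in> at_level K' (Suc n + 2 * tree_depth t)" "Q \<noteq> 0"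
      "\<And>x. (\<forall>f\<in>set (fs @ [h]). poly (snd f) x \<noteq> 0) \<Longrightarrow> poly Q x \<noteq> 0 \<Longrightarrow>
              run_tree x (map (value_at x) (fs @ [h])) t = r"
      using Arith.IH[of "fs @ [h]" K1 "Suc n"] Arith.prems(1) K1(1) by auto
    \<comment> \<open>A division needs its divisor to be nonzero.\<close>
    define D where "D = (if op = Div then fst g else [:1:])"
    have D: "D \<in> at_level K' (Suc n + 2 * tree_depth t)" "D \<noteq> 0"
    proof -
      have "D \<in> at_level K1 n"
        using fg(2) K1(1) by (auto simp: D_def good_fraction_def intro: at_level_const)
      thus "D \<in> at_level K' (Suc n + 2 * tree_depth t)"
        using at_level_mono[OF IH(1,2), of n "Suc n + 2 * tree_depth t"] by auto
      show "D \<noteq> 0" using False by (auto simp: D_def)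
    qed
    have "run_tree x (map (value_at x) fs) (Arith op u v t) = r"
      if x: "\<forall>f\<in>set fs. poly (snd f) x \<noteq> 0" "poly (D * Q) x \<noteq> 0" for x
    proof -
      have uv: "operand_value x (map (value_at x) fs) u = value_at x f" "poly (snd f) x \<noteq> 0"
          "operand_value x (map (value_at x) fs) v = value_at x g" "poly (snd g) x \<noteq> 0"
        using operand_fraction_value[of fs u x] operand_fraction_value[of fs v x] Arith.prems(1) x(1)
        by (simp_all add: f_def g_def)
      have "op = Div \<longrightarrow> poly (fst g) x \<noteq> 0" using x(2) by (auto simp: D_def)
      note h_val = combine_value[OF uv(2,4) this, folded h_def]
      have "run_tree x (map (value_at x) (fs @ [h])) t = r" using IH(6)[of x] x h_val(2) by simp
      thus ?thesis using uv h_val(1) by simp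
    qed
    moreover have "D * Q \<in> at_level K' (n + 2 * tree_depth (Arith op u v t))"
      using at_level_mult[OF D(1) IH(4)] by simp
    ultimately show ?thesis using IH K1 D(2)
      by (intro exI[of _ K'] exI[of _ "D * Q"] exI[of _ r]) auto
  qed
next
  case (Branch k t0 t1)
  define f where "f = fs ! k"
  have k: "k < length fs" "f \<in> set fs" using Branch.prems(1) by (auto simp: f_def)
  have zero_iff: "value_at x (fs ! k) = 0 \<longleftrightarrow> poly (fst (fs ! k)) x = 0"
    if "\<forall>f\<in>set fs. poly (snd f) x \<noteq> 0" for x
    using that k by (simp add: value_at_def f_def)
  define N where "N = n + 2 * tree_depth (Branch k t0 t1)"
  have N: "n + 2 * tree_depth t0 \<le> N" "Suc (n + 2 * tree_depth t1) \<le> N"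
    using max.cobounded1[of "tree_depth t0" "tree_depth t1"]
      max.cobounded2[of "tree_depth t1" "tree_depth t0"]
    unfolding N_def tree_depth.simps by (simp_all del: max.cobounded1 max.cobounded2)
  show ?case
  proof (cases "fst f = 0")
    case True
    obtain K' Q r where IH: "finite K'" "K \<subseteq> K'" "card K' \<le> card K + 2 * tree_depth t0"
      "Q \<in> at_level K' (n + 2 * tree_depth t0)" "Q \<noteq> 0"
      "\<And>x. (\<forall>f\<in>set fs. poly (snd f) x \<noteq> 0) \<Longrightarrow> poly Q x \<noteq> 0 \<Longrightarrow>
              run_tree x (map (value_at x) fs) t0 = r"
      using Branch.IH(1)[of fs K n] Branch.prems by auto
    have "Q \<in> at_level K' N"
      using at_level_mono[OF IH(1) subset_refl N(1)] IH(4) by blast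
    with IH True k show ?thesis
      by (intro exI[of _ K'] exI[of _ Q] exI[of _ r]) (auto simp: f_def N_def zero_iff)
  next
    case False
    obtain K' Q r where IH: "finite K'" "K \<subseteq> K'" "card K' \<le> card K + 2 * tree_depth t1"
      "Q \<in> at_level K' (n + 2 * tree_depth t1)" "Q \<noteq> 0"
      "\<And>x. (\<forall>f\<in>set fs. poly (snd f) x \<noteq> 0) \<Longrightarrow> poly Q x \<noteq> 0 \<Longrightarrow>
              run_tree x (map (value_at x) fs) t1 = r"
      using Branch.IH(2)[of fs K n] Branch.prems by auto
    have "fst f \<in> at_level K n" using Branch.prems(3) k(2) by (auto simp: good_fraction_def)
    hence "fst f \<in> at_level K' (n + 2 * tree_depth t1)"
      using at_level_mono[OF IH(1,2), of n "n + 2 * tree_depth t1"] by auto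
    from at_level_mult[OF this IH(4)] have "fst f * Q \<in> at_level K' N"
      using at_level_mono[OF IH(1) subset_refl N(2)] by blast
    with IH False k show ?thesis
      by (intro exI[of _ K'] exI[of _ "fst f * Q"] exI[of _ r]) (auto simp: f_def N_def zero_iff)
  qed
qed

text \<open>The generic outcome must be NO if \<open>S\<close> is finite, so that elements of \<open>S\<close> have to leave the generic
  path.\<close>

lemma ex_poly_vanishing_on_decided_set:
  assumes t: "tree_decides t S" and S: "finite S"
  shows "\<exists>K Q. finite K \<and> card K \<le> 2 * tree_depth t \<and> Q \<in> at_level K (2 * tree_depth t) \<and>
           Q \<noteq> 0 \<and> (\<forall>x\<in>S. poly Q x = 0)"
proof -
  have "wf_tree (length []) t" using t by (simp add: tree_decides_def)
  from generic_path[OF this finite.emptyI, of 0] obtain K Q r where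
    K: "finite K" "card K \<le> 2 * tree_depth t" and
    Q: "Q \<in> at_level K (2 * tree_depth t)" "Q \<noteq> 0" and
    r: "\<And>x. poly Q x \<noteq> 0 \<Longrightarrow> run_tree x [] t = r"
    by auto
  have "finite (S \<union> {x. poly Q x = 0})" using S Q(2) poly_roots_finite by blast
  then obtain x where "x \<notin> S" "poly Q x \<noteq> 0"
    using ex_new_if_finite[OF infinite_UNIV_char_0] by blast
  hence "r = Some False" using r[of x] t by (simp add: tree_decides_def)
  hence "poly Q x = 0" if "x \<in> S" for x
    using r[of x] t that by (auto simp: tree_decides_def)
  with K Q show ?thesis by blast
qed

section \<open>The depth of trees that decide the roots\<close>

text \<open>The hypothesis of \<open>subset_sums_collide\<close> for \<open>2 h + 2\<close> roots and at most \<open>2 h\<close> constants. The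
  logarithm of the left-hand side is less than \<open>\<Delta> ^ (2 h + 1) 2 ^ (10 (h + 1)^2)\<close>: one factor
  \<open>\<Delta>\<close> for every constant and one for the weight. Hence \<open>2 h + 2\<close> roots suffice.\<close>

lemma collision_count:
  fixes h :: nat
  defines "M \<equiv> 2 * h + 2" and "\<Delta> \<equiv> 2 ^ (10 * (h + 1)\<^sup>2)" and "E \<equiv> 2 ^ (2 * h)"
  assumes m: "m \<le> 2 * h" and e: "e \<le> E"
  shows "(2 * (\<Delta> ^ M * (2 ^ (E - 1)) ^ (M * \<Delta>)) + 1) ^ (Suc (M * \<Delta> * E) ^ m * e ^ M)
           < (2::nat) ^ (\<Delta> ^ M)"
proof -
  define \<delta> where "\<delta> = 10 * (h + 1)\<^sup>2"
  have \<Delta>: "\<Delta> = 2 ^ \<delta>" by (simp add: \<Delta>_def \<delta>_def)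
  have pos: "M \<ge> 1" "\<Delta> \<ge> 1" "E \<ge> 1" by (auto simp: M_def \<Delta> E_def)
  have M: "M \<le> 2 ^ (h + 1)" using Suc_leI[OF less_exp[of h]] by (simp add: M_def)
  have MDE: "M * \<Delta> * E \<le> 2 ^ (h + 1 + \<delta> + 2 * h)"
    unfolding \<Delta> E_def power_add using M by (intro mult_right_mono) auto
  have MDE1: "M * \<Delta> * E \<ge> 1" using pos by (simp add: Suc_le_eq)
  define L where "L = 4 * (M * \<Delta> * E)"
  have "\<delta> * M \<le> M * \<Delta>" using less_exp[of \<delta>] by (simp add: \<Delta> mult.commute)
  also have "\<dots> \<le> M * \<Delta> * E" using pos by simp
  finally have dM: "\<delta> * M \<le> M * \<Delta> * E" .
  have "\<Delta> ^ M * (2 ^ (E - 1)) ^ (M * \<Delta>) = (2::nat) ^ (\<delta> * M + (E - 1) * (M * \<Delta>))"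
    by (simp add: \<Delta> power_add flip: power_mult)
  also have "\<dots> \<le> 2 ^ (L - 2)"
  proof (rule power_increasing)
    have "(E - 1) * (M * \<Delta>) \<le> M * \<Delta> * E" by (simp add: mult.commute[of E] diff_mult_distrib2)
    with dM MDE1 show "\<delta> * M + (E - 1) * (M * \<Delta>) \<le> L - 2" unfolding L_def by linarith
  qed simp
  finally have "2 * (\<Delta> ^ M * (2 ^ (E - 1)) ^ (M * \<Delta>)) + 1 \<le> 2 * 2 ^ (L - 2) + (1::nat)" by simp
  also have "\<dots> \<le> 2 * 2 ^ (L - 2) + 2 * 2 ^ (L - 2)" by (intro add_left_mono) (simp add: Suc_le_eq)
  also have "\<dots> = 2 ^ (Suc (Suc (L - 2)))" by simp
  also have "Suc (Suc (L - 2)) = L" using MDE1 unfolding L_def by linarith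
  finally have base: "2 * (\<Delta> ^ M * (2 ^ (E - 1)) ^ (M * \<Delta>)) + 1 \<le> (2::nat) ^ L" .
  have "L \<le> 2 ^ (\<delta> + 3 * h + 3)"
    using MDE by (simp add: L_def power_add mult_ac)
  moreover have "Suc (M * \<Delta> * E) ^ m \<le> 2 ^ ((\<delta> + 3 * h + 2) * (2 * h))"
  proof -
    have "Suc (M * \<Delta> * E) \<le> 2 * (M * \<Delta> * E)" using MDE1 by linarith
    also have "\<dots> \<le> 2 ^ (\<delta> + 3 * h + 2)" using MDE by (simp add: power_add mult_ac)
    finally have "Suc (M * \<Delta> * E) ^ m \<le> (2 ^ (\<delta> + 3 * h + 2)) ^ m" by (rule power_mono) simp
    also have "\<dots> \<le> (2 ^ (\<delta> + 3 * h + 2)) ^ (2 * h)" by (rule power_increasing[OF m]) simp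
    finally show ?thesis by (simp only: power_mult)
  qed
  moreover have "e ^ M \<le> 2 ^ (2 * h * M)"
    using power_mono[OF e, of M] by (simp add: E_def flip: power_mult)
  ultimately have "L * (Suc (M * \<Delta> * E) ^ m * e ^ M) \<le>
      2 ^ (\<delta> + 3 * h + 3) * (2 ^ ((\<delta> + 3 * h + 2) * (2 * h)) * 2 ^ (2 * h * M))"
    by (intro mult_mono) auto
  also have "\<dots> = 2 ^ (\<delta> + 3 * h + 3 + ((\<delta> + 3 * h + 2) * (2 * h) + 2 * h * M))"
    by (simp only: power_add)
  also have "\<dots> < 2 ^ (\<delta> * M)"
    by (rule power_strict_increasing)
       (simp_all add: \<delta>_def M_def power2_eq_square algebra_simps)
  also have "\<dots> = \<Delta> ^ M" by (simp add: \<Delta> power_mult)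
  finally have exponent: "L * (Suc (M * \<Delta> * E) ^ m * e ^ M) < \<Delta> ^ M" .
  have "(2 * (\<Delta> ^ M * (2 ^ (E - 1)) ^ (M * \<Delta>)) + 1) ^ (Suc (M * \<Delta> * E) ^ m * e ^ M)
      \<le> (2 ^ L) ^ (Suc (M * \<Delta> * E) ^ m * e ^ M)"
    by (rule power_mono[OF base]) simp
  also have "\<dots> = 2 ^ (L * (Suc (M * \<Delta> * E) ^ m * e ^ M))" by (simp only: power_mult)
  also have "\<dots> < 2 ^ (\<Delta> ^ M)" by (rule power_strict_increasing[OF exponent]) simp
  finally show ?thesis .
qed

lemma tree_depth_lower_bound:
  assumes d: "d > 0" and t: "tree_decides t (Y d)"
  shows "d < 10 * (tree_depth t + 1)\<^sup>2"
proof (rule ccontr)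
  assume contra: "\<not> ?thesis"
  define h where "h = tree_depth t"
  define M where "M = 2 * h + 2"
  define \<Delta> :: nat where "\<Delta> = 2 ^ (10 * (h + 1)\<^sup>2)"
  have large: "10 * (h + 1)\<^sup>2 \<le> d" using contra by (simp add: h_def)
  have "M \<le> 10 * (h + 1)\<^sup>2" by (simp add: M_def power2_eq_square)
  with large have M: "M \<le> d" by linarith
  have \<Delta>: "\<Delta> \<le> 2 ^ d" unfolding \<Delta>_def using large by (intro power_increasing) auto
  obtain \<xi> where root: "\<And>k. k < d \<Longrightarrow> poly (p_poly d) (\<xi> k) = 0"
    and inj: "inj_on (\<lambda>A. \<Sum>\<alpha>\<in>A. \<Prod>k<M. \<xi> k ^ \<alpha> k) (Pow ({..<M} \<rightarrow>\<^sub>E {..<\<Delta>}))"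
    using p_poly_roots_subset_sums[OF d] M \<Delta> by metis
  have "finite (Y d)" unfolding Y_def by (rule poly_roots_finite[OF p_poly_nonzero])
  from ex_poly_vanishing_on_decided_set[OF t this, folded h_def] obtain K Q where
    K: "finite K" "card K \<le> 2 * h" and Q: "Q \<in> at_level K (2 * h)" "Q \<noteq> 0"
    and zero: "\<And>x. x \<in> Y d \<Longrightarrow> poly Q x = 0" by blast
  have Qsum: "isum (poly_monomials K (2 ^ (2 * h))) (2 ^ (2 ^ (2 * h) - 1)) Q"
    using Q(1) by (simp add: at_level_def)
  have vanish: "poly Q (\<xi> k) = 0" if "k \<in> {..<M}" for k
    using that M by (intro zero) (simp add: Y_def root)
  have "degree Q \<noteq> 0"
  proof
    assume "degree Q = 0"
    then obtain c where "Q = [:c:]" by (elim degree_eq_zeroE)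
    with vanish[of 0] Q(2) show False by (simp add: M_def)
  qed
  hence deg: "degree Q > 0" by simp
  note count = collision_count[OF K(2) isum_poly_monomials_degree[OF Qsum],
      folded M_def \<Delta>_def]
  have "\<not> inj_on (\<lambda>A. \<Sum>\<alpha>\<in>A. \<Prod>k<M. \<xi> k ^ \<alpha> k) (Pow ({..<M} \<rightarrow>\<^sub>E {..<\<Delta>}))"
    by (rule subset_sums_collide[OF K(1) _ Qsum Q(2) deg vanish]) (use count in auto)
  with inj show False by contradiction
qed

section \<open>Machines as decision trees\<close>

fun tree_operand_of :: "(int \<Rightarrow> tree_operand) \<Rightarrow> machine_operand \<Rightarrow> tree_operand" where
  "tree_operand_of \<sigma> (Cell i) = \<sigma> i"
| "tree_operand_of \<sigma> (Constant c) = Const c"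

text \<open>Trees can only test results, not the input or constants, so that the operand is first copied by
  adding zero to it.\<close>

definition zero_test :: "tree_operand \<Rightarrow> nat \<Rightarrow> decision_tree \<Rightarrow> decision_tree \<Rightarrow> decision_tree" where
  "zero_test u k t\<^sub>0 t\<^sub>1 = Arith Add u (Const 0) (Branch k t\<^sub>0 t\<^sub>1)"

text \<open>The decision tree that simulates \<open>T\<close> steps of a machine from node \<open>q\<close>. Shifts and assignments cost
  nothing: \<open>\<sigma>\<close> says where the current content of each cell is found in the tree, and \<open>k\<close> is
  the number of results so far. The output is read as NO if it is zero and as YES otherwise.
  When the steps are used up at a node other than \<open>Output\<close>, the answer is irrelevant.\<close>

primrec unroll :: "machine \<Rightarrow> nat \<Rightarrow> nat \<Rightarrow> (int \<Rightarrow> tree_operand) \<Rightarrow> nat \<Rightarrow> decision_tree" where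
  "unroll M 0 q \<sigma> k = zero_test (\<sigma> 1) k (Leaf False) (Leaf True)"
| "unroll M (Suc T) q \<sigma> k = (case M ! q of
      Output \<Rightarrow> zero_test (\<sigma> 1) k (Leaf False) (Leaf True)
    | Compute i f u v q' \<Rightarrow> Arith f (tree_operand_of \<sigma> u) (tree_operand_of \<sigma> v)
        (unroll M T q' (\<sigma>(i := Result k)) (Suc k))
    | Assign i u q' \<Rightarrow> unroll M T q' (\<sigma>(i := tree_operand_of \<sigma> u)) k
    | Test_Zero i q0 q1 \<Rightarrow> zero_test (\<sigma> i) k (unroll M T q0 \<sigma> (Suc k)) (unroll M T q1 \<sigma> (Suc k))
    | Shift_Left q' \<Rightarrow> unroll M T q' (\<lambda>i. \<sigma> (i + 1)) k
    | Shift_Right q' \<Rightarrow> unroll M T q' (\<lambda>i. \<sigma> (i - 1)) k)"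

lemma depth_unroll: "tree_depth (unroll M T q \<sigma> k) \<le> 2 * T + 2"
proof (induction T arbitrary: q \<sigma> k)
  case (Suc T)
  note IH = Suc[THEN order_trans]
  show ?case by (auto simp: zero_test_def split: node.split intro!: IH)
qed (simp add: zero_test_def)

lemma wf_operand_mono: "wf_operand k u \<Longrightarrow> k \<le> k' \<Longrightarrow> wf_operand k' u"
  by (cases u) auto

lemma wf_tree_operand_of: "\<forall>i. wf_operand k (\<sigma> i) \<Longrightarrow> wf_operand k (tree_operand_of \<sigma> u)"
  by (cases u) auto

lemma wf_unroll: "\<forall>i. wf_operand k (\<sigma> i) \<Longrightarrow> wf_tree k (unroll M T q \<sigma> k)"
proof (induction T arbitrary: q \<sigma> k)
  case (Suc T)
  have "\<forall>i. wf_operand (Suc k) (\<sigma> i)" using Suc.prems wf_operand_mono by (meson le_SucI order_refl)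
  with Suc show ?case
    by (auto simp: zero_test_def wf_tree_operand_of split: node.split intro!: Suc.IH)
qed (simp add: zero_test_def)

lemma operand_value_append:
  "wf_operand (length rs) u \<Longrightarrow> operand_value x (rs @ ws) u = operand_value x rs u"
  by (cases u) (auto simp: nth_append)

lemma operand_value_tree_operand_of:
  "operand_value x rs (tree_operand_of \<sigma> u) = cell_value (\<lambda>i. operand_value x rs (\<sigma> i)) u"
  by (cases u) auto

lemma run_zero_test:
  "run_tree x rs (zero_test u (length rs) t\<^sub>0 t\<^sub>1) =
     (let w = operand_value x rs u in run_tree x (rs @ [w]) (if w = 0 then t\<^sub>0 else t\<^sub>1))"
  by (simp add: zero_test_def)

lemma run_unroll:
  assumes "(machine_step M ^^ n) (q, s) (q', s')" "M ! q' = Output" "n \<le> T"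
    and "\<forall>i. wf_operand (length rs) (\<sigma> i)" "s = (\<lambda>i. operand_value x rs (\<sigma> i))"
  shows "run_tree x rs (unroll M T q \<sigma> (length rs)) = Some (s' 1 \<noteq> 0)"
  using assms
proof (induction T arbitrary: n q s rs \<sigma>)
  case 0
  then show ?case by (auto simp: run_zero_test Let_def)
next
  case (Suc T)
  show ?case
  proof (cases n)
    case 0
    with Suc.prems show ?thesis by (auto simp: run_zero_test Let_def)
  next
    case (Suc n')
    with Suc.prems(1) obtain q1 s1 where step: "exec_node (M ! q) s = Some (q1, s1)"
      and rest: "(machine_step M ^^ n') (q1, s1) (q', s')"
      by (metis relpowp_Suc_D2 machine_step_def fst_conv snd_conv surj_pair)
    have n': "n' \<le> T" using Suc Suc.prems(3) by simp
    note IH = Suc.IH[OF rest Suc.prems(2) n']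
    have wf': "\<forall>i. wf_operand (length (rs @ [w])) (\<sigma> i)" for w
      using Suc.prems(4) wf_operand_mono by (metis length_append_singleton le_SucI order_refl)
    have val': "operand_value x (rs @ [w]) (\<sigma> i) = s i" for w i
      using Suc.prems(4,5) by (simp add: operand_value_append)
    have len: "Suc (length rs) = length (rs @ [w])" for w by simp
    have opv: "operand_value x rs (tree_operand_of \<sigma> u) = cell_value s u" for u
      using Suc.prems(5) by (simp add: operand_value_tree_operand_of)
    show ?thesis
    proof (cases "M ! q")
      case (Compute i f u v q2)
      then obtain w where w: "arith f (cell_value s u) (cell_value s v) = Some w"
          "q1 = q2" "s1 = s(i := w)"
        using step by (auto split: option.splits)
      have "run_tree x (rs @ [w]) (unroll M T q1 (\<sigma>(i := Result (length rs))) (length (rs @ [w])))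
          = Some (s' 1 \<noteq> 0)"
        by (rule IH) (use wf' w(3) val' in \<open>auto simp: fun_eq_iff\<close>)
      then show ?thesis using Compute w(1,2) by (simp add: opv)
    next
      case (Assign i u q2)
      have "s1 = (\<lambda>j. operand_value x rs ((\<sigma>(i := tree_operand_of \<sigma> u)) j))"
        using step Assign Suc.prems(5) by (auto simp: operand_value_tree_operand_of)
      hence "run_tree x rs (unroll M T q1 (\<sigma>(i := tree_operand_of \<sigma> u)) (length rs))
          = Some (s' 1 \<noteq> 0)"
        by (intro IH) (use Suc.prems(4) wf_tree_operand_of in auto)
      then show ?thesis using Assign step by simp
    next
      case (Test_Zero i q2 q3)
      have "run_tree x (rs @ [s i]) (unroll M T q1 \<sigma> (length (rs @ [s i]))) = Some (s' 1 \<noteq> 0)"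
        by (rule IH) (use step Test_Zero wf' val' in \<open>auto simp: fun_eq_iff\<close>)
      then show ?thesis using Test_Zero step Suc.prems(5) by (auto simp: run_zero_test Let_def)
    next
      case (Shift_Left q2)
      have "run_tree x rs (unroll M T q1 (\<lambda>i. \<sigma> (i + 1)) (length rs)) = Some (s' 1 \<noteq> 0)"
        by (rule IH) (use step Shift_Left Suc.prems(4,5) in auto)
      then show ?thesis using Shift_Left step by simp
    next
      case (Shift_Right q2)
      have "run_tree x rs (unroll M T q1 (\<lambda>i. \<sigma> (i - 1)) (length rs)) = Some (s' 1 \<noteq> 0)"
        by (rule IH) (use step Shift_Right Suc.prems(4,5) in auto)
      then show ?thesis using Shift_Right step by simp
    qed (use step in simp)
  qed
qed

lemma machine_to_tree:
  assumes "machine_decides_in_time M S \<tau>"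
  shows "\<exists>t. tree_decides t S \<and> tree_depth t \<le> 2 * nat \<lfloor>\<tau>\<rfloor> + 2"
proof -
  define \<sigma> where "\<sigma> = (\<lambda>i::int. Const 0)(0 := Const 1, 1 := Input)"
  define t where "t = unroll M (nat \<lfloor>\<tau>\<rfloor>) 0 \<sigma> 0"
  have wf: "\<forall>i. wf_operand k (\<sigma> i)" for k by (simp add: \<sigma>_def)
  have run: "run_tree x [] t = Some (x \<in> S)" for x
  proof -
    obtain n q s where n: "real n \<le> \<tau>" "(machine_step M ^^ n) (0, input_tape x) (q, s)"
        "M ! q = Output" "s 1 = (if x \<in> S then 1 else 0)"
      using assms unfolding machine_decides_in_time_def machine_outputs_def by blast
    have "n \<le> nat \<lfloor>\<tau>\<rfloor>" using n(1) by (simp add: le_nat_floor)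
    from run_unroll[OF n(2,3) this, of "[]" \<sigma> x] wf
    have "run_tree x [] t = Some (s 1 \<noteq> 0)"
      by (auto simp: t_def \<sigma>_def input_tape_def fun_eq_iff)
    thus ?thesis using n(4) by simp
  qed
  have "tree_decides t S" using run wf_unroll[OF wf] by (simp add: tree_decides_def t_def)
  moreover have "tree_depth t \<le> 2 * nat \<lfloor>\<tau>\<rfloor> + 2" unfolding t_def by (rule depth_unroll)
  ultimately show ?thesis by blast
qed

section \<open>The lower bound\<close>

theorem mainTheorem2:
  shows "\<not> (\<exists>a b :: real. a > 0 \<and> b > 0 \<and>
    (\<forall>d :: nat. d \<ge> 2 \<longrightarrow>
       (\<exists>M. machine_decides_in_time M (Y d) (a * ln (real d) powr b)) \<or>
       (\<exists>t. tree_decides t (Y d) \<and> real (tree_depth t) \<le> a * ln (real d) powr b)))"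
proof
  assume "\<exists>a b :: real. a > 0 \<and> b > 0 \<and>
    (\<forall>d :: nat. d \<ge> 2 \<longrightarrow>
       (\<exists>M. machine_decides_in_time M (Y d) (a * ln (real d) powr b)) \<or>
       (\<exists>t. tree_decides t (Y d) \<and> real (tree_depth t) \<le> a * ln (real d) powr b))"
  then obtain a b :: real where ab: "a > 0" "b > 0"
    and fast: "\<And>d :: nat. d \<ge> 2 \<Longrightarrow>
       (\<exists>M. machine_decides_in_time M (Y d) (a * ln (real d) powr b)) \<or>
       (\<exists>t. tree_decides t (Y d) \<and> real (tree_depth t) \<le> a * ln (real d) powr b)" by blast
  \<comment> \<open>As machines unroll to trees, \<open>d\<close> is in both cases below a quadratic polynomial in the time.\<close>
  have upper: "real d < 10 * (2 * (a * ln (real d) powr b) + 3)\<^sup>2" if "d \<ge> 2" for d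
  proof -
    define \<tau> where "\<tau> = a * ln (real d) powr b"
    have \<tau>: "\<tau> \<ge> 0" using ab by (simp add: \<tau>_def)
    obtain t where t: "tree_decides t (Y d)" "real (tree_depth t) \<le> 2 * \<tau> + 2"
    proof (cases "\<exists>M. machine_decides_in_time M (Y d) \<tau>")
      case True
      then obtain t where t: "tree_decides t (Y d)" "tree_depth t \<le> 2 * nat \<lfloor>\<tau>\<rfloor> + 2"
        using machine_to_tree by blast
      have "real (nat \<lfloor>\<tau>\<rfloor>) \<le> \<tau>" using \<tau> by simp
      with t that show ?thesis by force
    next
      case False
      then obtain t where "tree_decides t (Y d)" "real (tree_depth t) \<le> \<tau>"
        using fast[OF \<open>d \<ge> 2\<close>] by (auto simp: \<tau>_def)
      with that \<tau> show ?thesis by force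
    qed
    have "d < 10 * (tree_depth t + 1)\<^sup>2" using \<open>d \<ge> 2\<close> t(1) by (intro tree_depth_lower_bound) auto
    hence "real d < real (10 * (tree_depth t + 1)\<^sup>2)" by (simp only: of_nat_less_iff)
    also have "\<dots> = 10 * (real (tree_depth t) + 1)\<^sup>2" by simp
    also have "\<dots> \<le> 10 * (2 * \<tau> + 3)\<^sup>2" using t(2) by (intro mult_left_mono power_mono) auto
    finally show ?thesis by (simp add: \<tau>_def)
  qed
  have "eventually (\<lambda>d::nat. 10 * (2 * (a * ln (real d) powr b) + 3)\<^sup>2 < real d) at_top"
    using ab by real_asymp
  hence "eventually (\<lambda>d::nat. 10 * (2 * (a * ln (real d) powr b) + 3)\<^sup>2 < real d \<and> d \<ge> 2) at_top"
    by (rule eventually_conj) (rule eventually_ge_at_top)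
  then obtain d :: nat where "10 * (2 * (a * ln (real d) powr b) + 3)\<^sup>2 < real d" "d \<ge> 2"
    by (auto simp: eventually_sequentially)
  with upper[of d] show False by simp
qed

end
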